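(* Let $B$, $G$ and $R$ be three pairwise disjoint sets of points in the plane such that $B\cup G$ is in general position (no three points of $B\cup G$ are collinear) and every line through a point in $B$ and a point in $G$ passes through a point in $R$. Assume that $|B|=|G|=n>6$, that $|R|<\frac{3}{2}n$, and that $B\cup G\cup R$ is contained in a reducible cubic curve $c$ that is a union of a quadric $Q$ and a line $\ell$. Then $B, G\subset Q$, and $Q$ must be an ellipse. Moreover, if $\ell$ is the line at infinity, then, up to an affine transformation that takes $Q$ to a circle, each of $B$ and $G$ is a subset of a set of vertices of some regular $m$-gon contained in $Q$ (that is, with its vertices on $Q$), where $m\le |R|$. The bound $\frac{3}{2}n$ on $|R|$ in this statement is best possible.
   Context: The plane is the real plane together with its line at infinity; a point on the line at infinity corresponds to a direction, and a line passes through that point if and only if it has that direction. A quadric here is a conic that is an ellipse (circles included), a parabola or a hyperbola.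
   Formalization: "Q must be an ellipse" fails for an ordinary line ℓ (a projective image of a regular 2n-gon example has Q a hyperbola); it is stated as: every projective map taking ℓ to the line at infinity takes Q to an ellipse, and Q itself is an ellipse when ℓ is the line at infinity. *)

theory Defs
  imports "HOL-Analysis.Analysis"
begin

definition proportional :: "real^3 \<Rightarrow> real^3 \<Rightarrow> bool" where
  "proportional u v \<longleftrightarrow> u \<noteq> 0 \<and> v \<noteq> 0 \<and> (\<exists>k. v = k *\<^sub>R u)"

lemma part_equivp_proportional: "part_equivp proportional"
proof (rule part_equivpI)
  show "\<exists>u. proportional u u"
    by (rule exI[of _ "axis 1 1"])
      (auto simp: proportional_def axis_eq_0_iff intro: exI[of _ 1])
  show "symp proportional"
  proof (rule sympI)
    fix u v assume uv: "proportional u v"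
    then obtain k where k: "v = k *\<^sub>R u" and "u \<noteq> 0" "v \<noteq> 0"
      by (auto simp: proportional_def)
    then have "u = (1 / k) *\<^sub>R v" by auto
    with \<open>u \<noteq> 0\<close> \<open>v \<noteq> 0\<close> show "proportional v u"
      unfolding proportional_def by blast
  qed
  show "transp proportional"
    by (rule transpI) (auto simp: proportional_def)
qed

text \<open>The real plane together with its line at infinity, in homogeneous coordinates.\<close>

quotient_type pplane = "real^3" / partial: proportional
  by (rule part_equivp_proportional)

text \<open>Only meaningful for nonzero vectors.\<close>

definition proj :: "real^3 \<Rightarrow> pplane" where
  "proj v = abs_pplane v"

definition aff :: "real^2 \<Rightarrow> pplane" where
  "aff p = proj (vector [p$1, p$2, 1])"

text \<open>The point at infinity in the direction of a nonzero vector; proportional vectors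
  give the same point.\<close>

definition at_inf :: "real^2 \<Rightarrow> pplane" where
  "at_inf u = proj (vector [u$1, u$2, 0])"

definition line_at_infinity :: "pplane set" where
  "line_at_infinity = {at_inf u | u. u \<noteq> 0}"

definition is_line :: "pplane set \<Rightarrow> bool" where
  "is_line L \<longleftrightarrow> L = line_at_infinity \<or>
     (\<exists>p u. u \<noteq> 0 \<and> L = insert (at_inf u) {aff (p + t *\<^sub>R u) | t. True})"

definition general_position :: "pplane set \<Rightarrow> bool" where
  "general_position S \<longleftrightarrow>
     (\<forall>p\<in>S. \<forall>q\<in>S. \<forall>r\<in>S. p \<noteq> q \<and> p \<noteq> r \<and> q \<noteq> r \<longrightarrow>
        \<not> (\<exists>L. is_line L \<and> p \<in> L \<and> q \<in> L \<and> r \<in> L))"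

definition projective_transformation :: "(pplane \<Rightarrow> pplane) \<Rightarrow> bool" where
  "projective_transformation T \<longleftrightarrow>
     (\<exists>M :: real^3^3. invertible M \<and> (\<forall>v. v \<noteq> 0 \<longrightarrow> T (proj v) = proj (M *v v)))"

definition affine_transformation :: "(pplane \<Rightarrow> pplane) \<Rightarrow> bool" where
  "affine_transformation T \<longleftrightarrow>
     (\<exists>(A :: real^2^2) b. invertible A \<and> (\<forall>p. T (aff p) = aff (A *v p + b)) \<and>
        (\<forall>u. u \<noteq> 0 \<longrightarrow> T (at_inf u) = at_inf (A *v u)))"

definition is_circle :: "pplane set \<Rightarrow> bool" where
  "is_circle C \<longleftrightarrow> (\<exists>c r. r > 0 \<and> C = aff ` sphere c r)"

definition is_ellipse :: "pplane set \<Rightarrow> bool" where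
  "is_ellipse Q \<longleftrightarrow> (\<exists>T C. affine_transformation T \<and> is_circle C \<and> Q = T ` C)"

text \<open>Parabolas and hyperbolas contain their points at infinity, that is, the direction of
  the axis and the directions of the two asymptotes, respectively. They are the affine
  images of \<open>y = x\<^sup>2\<close> and \<open>x y = 1\<close>.\<close>

definition is_parabola :: "pplane set \<Rightarrow> bool" where
  "is_parabola Q \<longleftrightarrow> (\<exists>T. affine_transformation T \<and>
     Q = T ` (aff ` {p. p$2 = (p$1)\<^sup>2} \<union> {at_inf (vector [0, 1])}))"

definition is_hyperbola :: "pplane set \<Rightarrow> bool" where
  "is_hyperbola Q \<longleftrightarrow> (\<exists>T. affine_transformation T \<and>
     Q = T ` (aff ` {p. p$1 * p$2 = 1} \<union> {at_inf (vector [1, 0]), at_inf (vector [0, 1])}))"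

definition is_quadric :: "pplane set \<Rightarrow> bool" where
  "is_quadric Q \<longleftrightarrow> is_ellipse Q \<or> is_parabola Q \<or> is_hyperbola Q"

definition regular_polygon_vertices :: "nat \<Rightarrow> pplane set \<Rightarrow> bool" where
  "regular_polygon_vertices m V \<longleftrightarrow> m \<ge> 3 \<and>
     (\<exists>c r t. r > 0 \<and>
        V = (\<lambda>k. aff (c + r *\<^sub>R vector [cos (t + 2 * pi * real k / real m),
                                       sin (t + 2 * pi * real k / real m)])) ` {..<m})"

definition within_inscribed_regular_polygon :: "nat \<Rightarrow> pplane set \<Rightarrow> pplane set \<Rightarrow> bool" where
  "within_inscribed_regular_polygon m C S \<longleftrightarrow>
     (\<exists>V. regular_polygon_vertices m V \<and> V \<subseteq> C \<and> S \<subseteq> V)"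

text \<open>The same \<open>m\<close> serves for both sets, but the two \<open>m\<close>-gons may differ.\<close>

definition polygonal_up_to_affinity ::
    "pplane set \<Rightarrow> pplane set \<Rightarrow> pplane set \<Rightarrow> pplane set \<Rightarrow> bool" where
  "polygonal_up_to_affinity Q B G R \<longleftrightarrow>
     (\<exists>T m. affine_transformation T \<and> is_circle (T ` Q) \<and> m \<le> card R \<and>
        within_inscribed_regular_polygon m (T ` Q) (T ` B) \<and>
        within_inscribed_regular_polygon m (T ` Q) (T ` G))"

text \<open>The bound on the size of \<open>R\<close> is deliberately left out, since its optimality is a claim
  about configurations that violate it. Finiteness of \<open>R\<close> is explicit because \<open>card\<close> is \<open>0\<close>
  on infinite sets.\<close>

definition pierced_configuration ::
    "nat \<Rightarrow> pplane set \<Rightarrow> pplane set \<Rightarrow> pplane set \<Rightarrow> pplane set \<Rightarrow> pplane set \<Rightarrow> bool" where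
  "pierced_configuration n B G R Q l \<longleftrightarrow>
     B \<inter> G = {} \<and> B \<inter> R = {} \<and> G \<inter> R = {} \<and>
     general_position (B \<union> G) \<and>
     (\<forall>b\<in>B. \<forall>g\<in>G. \<forall>L. is_line L \<and> b \<in> L \<and> g \<in> L \<longrightarrow> (\<exists>r\<in>R. r \<in> L)) \<and>
     card B = n \<and> card G = n \<and> n > 6 \<and> finite R \<and>
     is_quadric Q \<and> is_line l \<and> B \<union> G \<union> R \<subseteq> Q \<union> l"

end

(*
  A projective map moves the line l to infinity and the quadric Q to the unit circle, the parabola
  x^2 = y or the hyperbola x y = 1: pull the line back to a binary quadratic form along a
  parametrization of Q by the projective line, and distinguish the sign of the discriminant.
  A point of B on l but off Q would force about n red points off l and about n more on l. Hence
  B and G lie on Q off l, and the blocking points lie on l.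
  The direction of a chord of Q depends only on the product of its end points in the group
  of the quadric: unit complex numbers for the circle, nonzero reals for the hyperbola,
  the exponentials of the reals for the parabola. So card R bounds the product set of B and G, and a
  product set of fewer than 3 n / 2 elements puts B and G into cosets of a finite subgroup, whose
  order is at least n > 6 and at most card R. Finite groups of reals have at most two elements,
  which leaves the circle, where the cosets are regular polygons.
*)
theory Submission
  imports Defs
begin

text \<open>The constant 3/2 enters through a majority argument. Two dilates of an n-element set
  that lie in a product set of fewer than 3n/2 elements share more than n/2 elements, and two
  subsets that each contain more than half of an n-element set must meet; this makes the set of
  quotients closed under division. The group laws are all written as multiplication in a field, so
  that one lemma serves the three normal forms. The bound m <= |R| needs more than membership in
  cosets: the product set is shown to contain a full coset of the subgroup. For sharpness, the
  obstacle is that \<open>polygonal_up_to_affinity\<close> allows any affinity that yields a circle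
  and any regular polygons on it. Two rigidity facts remove this freedom: an affinity that maps the
  unit circle into a circle multiplies all lengths by one factor, and a regular polygon with its
  vertices on a circle has the radius of that circle. Chord lengths then determine angles, and two
  adjacent vertices of the 4k-gon force at least 4k vertices.\<close>

section \<open>The projective plane in homogeneous coordinates\<close>

text \<open>One representative satisfying \<open>q\<close> is enough here. The definition is meant
  for predicates that are invariant under nonzero scaling, where all representatives agree.\<close>

definition locus :: "(real^3 \<Rightarrow> bool) \<Rightarrow> pplane set" where
  "locus q = {proj v | v. v \<noteq> 0 \<and> q v}"

lemma proj_eq_iff:
  assumes "u \<noteq> 0" "v \<noteq> 0"
  shows "proj u = proj v \<longleftrightarrow> (\<exists>k. v = k *\<^sub>R u)"
proof -
  have refl: "proportional u u" "proportional v v"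
    using assms by (auto simp: proportional_def intro: exI[of _ 1])
  have "proj u = proj v \<longleftrightarrow> proportional u v"
    using Quotient3_rel[OF Quotient3_pplane, of u v] refl by (simp add: proj_def)
  then show ?thesis using assms by (auto simp: proportional_def)
qed

lemma proj_scale: "k \<noteq> 0 \<Longrightarrow> v \<noteq> 0 \<Longrightarrow> proj (k *\<^sub>R v) = proj v"
  by (subst eq_commute, subst proj_eq_iff) auto

lemma rep_pplane_nonzero: "rep_pplane x \<noteq> 0"
  using Quotient3_rep_reflp[OF Quotient3_pplane, of x] by (simp add: proportional_def)

lemma proj_rep_pplane: "proj (rep_pplane x) = x"
  unfolding proj_def by (rule Quotient3_abs_rep[OF Quotient3_pplane])

lemma pplane_cases:
  obtains v where "v \<noteq> 0" "x = proj v"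
  by (metis rep_pplane_nonzero proj_rep_pplane)

lemma vec3_eq_iff: "(u::real^3) = v \<longleftrightarrow> u$1 = v$1 \<and> u$2 = v$2 \<and> u$3 = v$3"
  by (simp add: vec_eq_iff forall_3)

lemma vec2_eq_iff: "(u::real^2) = v \<longleftrightarrow> u$1 = v$1 \<and> u$2 = v$2"
  by (simp add: vec_eq_iff forall_2)

lemma proj_mem_locus:
  assumes "v \<noteq> 0" "\<And>k v. k \<noteq> 0 \<Longrightarrow> q (k *\<^sub>R v) \<longleftrightarrow> q v"
  shows "proj v \<in> locus q \<longleftrightarrow> q v"
proof
  assume "proj v \<in> locus q"
  then obtain u where u: "u \<noteq> 0" "q u" "proj v = proj u" by (auto simp: locus_def)
  then obtain k where "u = k *\<^sub>R v" using proj_eq_iff assms(1) by blast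
  with u assms(2)[of k v] show "q v" by auto
qed (use assms in \<open>auto simp: locus_def\<close>)

lemma proj_mem_line: "v \<noteq> 0 \<Longrightarrow> proj v \<in> locus (\<lambda>v. w \<bullet> v = 0) \<longleftrightarrow> w \<bullet> v = 0"
  by (rule proj_mem_locus) auto

lemma aff_chart:
  assumes "v$3 \<noteq> 0" shows "proj v = aff (vector [v$1 / v$3, v$2 / v$3])"
proof -
  have "v \<noteq> 0" using assms by (auto simp: vec3_eq_iff)
  have "vector [v$1 / v$3, v$2 / v$3, 1] = (1 / v$3) *\<^sub>R v"
    using assms by (simp add: vec3_eq_iff)
  then show ?thesis unfolding aff_def
    using proj_scale[of "1 / v$3" v] assms \<open>v \<noteq> 0\<close> by simp
qed

lemma aff_vec_nonzero: "(vector [x, y, 1] :: real^3) \<noteq> 0"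
  by (simp add: vec3_eq_iff)

lemma at_inf_vec_nonzero: "(u::real^2) \<noteq> 0 \<Longrightarrow> (vector [u$1, u$2, 0] :: real^3) \<noteq> 0"
  by (simp add: vec3_eq_iff vec2_eq_iff)

lemma at_inf_chart:
  assumes "v \<noteq> 0" "v$3 = 0"
  shows "proj v = at_inf (vector [v$1, v$2])" "vector [v$1, v$2] \<noteq> (0 :: real^2)"
proof -
  have "v = vector [v$1, v$2, 0]" using assms by (simp add: vec3_eq_iff)
  then show "proj v = at_inf (vector [v$1, v$2])" by (simp add: at_inf_def)
  show "vector [v$1, v$2] \<noteq> (0 :: real^2)" using assms by (auto simp: vec2_eq_iff vec3_eq_iff)
qed

lemma inner_3: "(u::real^3) \<bullet> v = u$1 * v$1 + u$2 * v$2 + u$3 * v$3"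
  by (simp add: inner_vec_def sum_3)

lemma aff_mem_locus:
  assumes "\<And>k v. k \<noteq> 0 \<Longrightarrow> q (k *\<^sub>R v) \<longleftrightarrow> q v"
  shows "aff p \<in> locus q \<longleftrightarrow> q (vector [p$1, p$2, 1])"
  unfolding aff_def using assms by (intro proj_mem_locus aff_vec_nonzero)

lemma at_inf_mem_locus:
  assumes "u \<noteq> 0" "\<And>k v. k \<noteq> 0 \<Longrightarrow> q (k *\<^sub>R v) \<longleftrightarrow> q v"
  shows "at_inf u \<in> locus q \<longleftrightarrow> q (vector [u$1, u$2, 0])"
  unfolding at_inf_def using assms by (intro proj_mem_locus at_inf_vec_nonzero)

lemma aff_mem_line:
  "aff p \<in> locus (\<lambda>v. w \<bullet> v = 0) \<longleftrightarrow> w$1 * p$1 + w$2 * p$2 + w$3 = 0"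
  by (subst aff_mem_locus) (auto, auto simp: inner_3)

lemma at_inf_mem_line:
  "u \<noteq> 0 \<Longrightarrow> at_inf u \<in> locus (\<lambda>v. w \<bullet> v = 0) \<longleftrightarrow> w$1 * u$1 + w$2 * u$2 = 0"
  by (subst at_inf_mem_locus) (auto, auto simp: inner_3)

lemma pplane_affine_cases:
  obtains (finite) p where "x = aff p" | (infinite) u where "u \<noteq> 0" "x = at_inf u"
proof -
  obtain v where v: "v \<noteq> 0" "x = proj v" by (rule pplane_cases)
  show ?thesis
  proof (cases "v$3 = 0")
    case True then show ?thesis using at_inf_chart[OF v(1)] v(2) infinite by blast
  next
    case False then show ?thesis using aff_chart v(2) finite by blast
  qed
qed

lemma aff_eq_iff: "aff p = aff p' \<longleftrightarrow> p = p'"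
  unfolding aff_def by (subst proj_eq_iff) (auto simp: aff_vec_nonzero vec3_eq_iff vec2_eq_iff)

lemma at_inf_eq_iff:
  assumes "u \<noteq> 0" "v \<noteq> 0" shows "at_inf u = at_inf v \<longleftrightarrow> (\<exists>k. v = k *\<^sub>R u)"
  unfolding at_inf_def
  by (subst proj_eq_iff) (use assms in \<open>auto simp: at_inf_vec_nonzero vec3_eq_iff vec2_eq_iff\<close>)

lemma aff_neq_at_inf: "u \<noteq> 0 \<Longrightarrow> aff p \<noteq> at_inf u"
  unfolding at_inf_def aff_def
  by (subst proj_eq_iff) (auto simp: at_inf_vec_nonzero aff_vec_nonzero, auto simp: vec3_eq_iff vec2_eq_iff)

lemma parallel_2:
  assumes "(u::real^2) \<noteq> 0" "u$1 * v$2 = u$2 * v$1"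
  shows "\<exists>k. v = k *\<^sub>R u"
proof (cases "u$1 = 0")
  case True
  then have "u$2 \<noteq> 0" using assms(1) by (auto simp: vec2_eq_iff)
  then have "v = (v$2 / u$2) *\<^sub>R u" using assms True by (simp add: vec2_eq_iff)
  then show ?thesis by blast
next
  case False
  then have "v = (v$1 / u$1) *\<^sub>R u" using assms by (simp add: vec2_eq_iff field_simps)
  then show ?thesis by blast
qed

lemma line_at_infinity_locus: "line_at_infinity = locus (\<lambda>v. v$3 = 0)"
proof (intro set_eqI)
  fix x show "x \<in> line_at_infinity \<longleftrightarrow> x \<in> locus (\<lambda>v. v$3 = 0)"
    by (cases x rule: pplane_affine_cases)
      (auto simp: aff_mem_locus at_inf_mem_locus line_at_infinity_def aff_neq_at_inf[symmetric] dest: aff_neq_at_inf)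
qed

text \<open>The coefficient vector is the cross product of (u, 0) and (p, 1), the homogeneous
  coordinates of two points of the line.\<close>

lemma affine_line_locus:
  assumes "u \<noteq> 0"
  shows "insert (at_inf u) {aff (p + t *\<^sub>R u) | t. True} =
    locus (\<lambda>v. vector [u$2, - u$1, u$1 * p$2 - u$2 * p$1] \<bullet> v = 0)" (is "?L = locus ?q")
proof (intro set_eqI)
  fix x show "x \<in> ?L \<longleftrightarrow> x \<in> locus ?q"
  proof (cases x rule: pplane_affine_cases)
    case (finite r)
    have "x \<in> ?L \<longleftrightarrow> (\<exists>k. r - p = k *\<^sub>R u)"
      using finite assms by (auto simp: aff_eq_iff aff_neq_at_inf algebra_simps)
    also have "\<dots> \<longleftrightarrow> u$1 * (r - p)$2 = u$2 * (r - p)$1"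
    proof
      assume "\<exists>k. r - p = k *\<^sub>R u"
      then obtain k where "r - p = k *\<^sub>R u" by blast
      then show "u$1 * (r - p)$2 = u$2 * (r - p)$1" by (simp only: vector_scaleR_component) simp
    qed (use parallel_2[OF assms] in blast)
    also have "\<dots> \<longleftrightarrow> x \<in> locus ?q"
      unfolding finite aff_mem_line by (auto simp: algebra_simps)
    finally show ?thesis .
  next
    case (infinite v)
    have "x \<in> ?L \<longleftrightarrow> (\<exists>k. v = k *\<^sub>R u)"
      using infinite assms at_inf_eq_iff[of u v] aff_neq_at_inf[OF infinite(1)] by auto metis+
    also have "\<dots> \<longleftrightarrow> u$1 * v$2 = u$2 * v$1"
      using parallel_2[OF assms, of v] by auto
    also have "\<dots> \<longleftrightarrow> x \<in> locus ?q"
      unfolding infinite(2) at_inf_mem_line[OF infinite(1)] by (auto simp: algebra_simps)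
    finally show ?thesis .
  qed
qed

text \<open>Trades the description of lines in the affine chart for a nonzero coefficient vector,
  which treats the line at infinity like any other and transforms well under matrices.\<close>

lemma is_line_iff: "is_line L \<longleftrightarrow> (\<exists>w. w \<noteq> 0 \<and> L = locus (\<lambda>v. w \<bullet> v = 0))"
proof
  assume "is_line L"
  then consider "L = line_at_infinity"
    | p u where "u \<noteq> 0" "L = insert (at_inf u) {aff (p + t *\<^sub>R u) | t. True}"
    unfolding is_line_def by blast
  then show "\<exists>w. w \<noteq> 0 \<and> L = locus (\<lambda>v. w \<bullet> v = 0)"
  proof cases
    case 1
    then show ?thesis unfolding line_at_infinity_locus
      by (intro exI[of _ "vector [0,0,1]"]) (auto simp: inner_3 vec3_eq_iff)
  next
    case 2
    then show ?thesis unfolding affine_line_locus[OF 2(1)]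
      by (intro exI[of _ "vector [u$2, - u$1, u$1 * p$2 - u$2 * p$1]"])
        (auto simp: vec3_eq_iff vec2_eq_iff)
  qed
next
  assume "\<exists>w. w \<noteq> 0 \<and> L = locus (\<lambda>v. w \<bullet> v = 0)"
  then obtain w where w: "w \<noteq> 0" "L = locus (\<lambda>v. w \<bullet> v = 0)" by blast
  show "is_line L"
  proof (cases "w$1 = 0 \<and> w$2 = 0")
    case True
    then have "w$3 \<noteq> 0" using w by (auto simp: vec3_eq_iff)
    then have "L = line_at_infinity"
      using w True by (simp add: line_at_infinity_locus inner_3)
    then show ?thesis by (simp add: is_line_def)
  next
    case False
    then have pos: "(w$1)\<^sup>2 + (w$2)\<^sup>2 \<noteq> 0" by (simp add: sum_power2_eq_zero_iff)
    \<comment> \<open>\<open>p\<close> is the foot of the perpendicular from the origin to the line,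
      and \<open>u\<close> is the normal (w1, w2) turned by a right angle.\<close>
    define k where "k = - w$3 / ((w$1)\<^sup>2 + (w$2)\<^sup>2)"
    define p :: "real^2" where "p = k *\<^sub>R vector [w$1, w$2]"
    define u :: "real^2" where "u = vector [- w$2, w$1]"
    have "u \<noteq> 0" using False by (auto simp: u_def vec2_eq_iff)
    have "w$1 * p$1 + w$2 * p$2 = k * ((w$1)\<^sup>2 + (w$2)\<^sup>2)"
      unfolding p_def by (simp add: algebra_simps power2_eq_square)
    also have "\<dots> = - w$3" using pos by (simp add: k_def)
    finally have "vector [u$2, - u$1, u$1 * p$2 - u$2 * p$1] = w"
      by (simp add: vec3_eq_iff u_def)
    then show ?thesis using affine_line_locus[OF \<open>u \<noteq> 0\<close>, of p] w \<open>u \<noteq> 0\<close>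
      unfolding is_line_def by metis
  qed
qed

text \<open>A coefficient vector of a line through both points is orthogonal to \<open>u\<close> and
  \<open>v\<close>, so by Lagrange's identity its cross product with \<open>cross3 u v\<close>
  vanishes and the two are proportional.\<close>

lemma line_through_unique:
  assumes "is_line L" "is_line L'" "x \<noteq> y" "x \<in> L" "y \<in> L" "x \<in> L'" "y \<in> L'"
  shows "L = L'"
proof -
  obtain u v where u: "u \<noteq> 0" "x = proj u" and v: "v \<noteq> 0" "y = proj v"
    by (metis pplane_cases)
  have *: "L = locus (\<lambda>z. cross3 u v \<bullet> z = 0)" if L: "is_line L" "x \<in> L" "y \<in> L" for L
  proof -
    from L obtain w where w: "w \<noteq> 0" "L = locus (\<lambda>v. w \<bullet> v = 0)" by (auto simp: is_line_iff)
    have 0: "w \<bullet> u = 0" "w \<bullet> v = 0" using L u v w proj_mem_line by blast+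
    have ne: "cross3 u v \<noteq> 0"
    proof
      assume "cross3 u v = 0"
      then have "collinear {0, u, v}" by (simp add: cross_eq_0)
      then obtain k where "v = k *\<^sub>R u" using u v by (auto simp: collinear_lemma)
      then show False using assms(3) u v proj_eq_iff by blast
    qed
    have "cross3 w (cross3 u v) = 0" using 0 by (simp add: Lagrange)
    then have "collinear {0, w, cross3 u v}" by (simp add: cross_eq_0)
    then obtain k where k: "cross3 u v = k *\<^sub>R w" using w ne by (auto simp: collinear_lemma)
    then have "k \<noteq> 0" using ne by auto
    then show ?thesis using w k by simp
  qed
  show ?thesis using *[of L] *[of L'] assms by simp
qed

lemma line_through_exists:
  assumes "x \<noteq> y" obtains L where "is_line L" "x \<in> L" "y \<in> L"
proof -
  obtain u v where u: "u \<noteq> 0" "x = proj u" and v: "v \<noteq> 0" "y = proj v"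
    by (metis pplane_cases)
  have ne: "cross3 u v \<noteq> 0"
  proof
    assume "cross3 u v = 0"
    then have "collinear {0, u, v}" by (simp add: cross_eq_0)
    then obtain k where "v = k *\<^sub>R u" using u v by (auto simp: collinear_lemma)
    then show False using assms(1) u v proj_eq_iff by blast
  qed
  show ?thesis
  proof (rule that)
    show "is_line (locus (\<lambda>z. cross3 u v \<bullet> z = 0))" using ne is_line_iff by blast
  qed (use u v in \<open>auto simp: proj_mem_line dot_cross_self\<close>)
qed

section \<open>Projective maps as invertible matrices\<close>

definition pmap :: "real^3^3 \<Rightarrow> pplane \<Rightarrow> pplane" where
  "pmap M x = proj (M *v rep_pplane x)"

lemma invertible_mult_eq_0_iff: "invertible (M::real^'n^'n) \<Longrightarrow> M *v v = 0 \<longleftrightarrow> v = 0"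
  using matrix_left_invertible_ker[of M] by (auto simp: invertible_left_inverse)

text \<open>Linearity makes the arbitrary representative in \<open>pmap\<close> harmless: another
  choice only rescales the image.\<close>

lemma pmap_proj:
  assumes "invertible M" "v \<noteq> 0" shows "pmap M (proj v) = proj (M *v v)"
proof -
  let ?u = "rep_pplane (proj v)"
  obtain k where k: "v = k *\<^sub>R ?u"
    using proj_eq_iff[OF rep_pplane_nonzero assms(2)] by (auto simp: proj_rep_pplane)
  then have "k \<noteq> 0" using assms by auto
  have "M *v v = k *\<^sub>R (M *v ?u)" by (subst k) (simp add: matrix_vector_mult_scaleR)
  then show ?thesis unfolding pmap_def
    using proj_scale[OF \<open>k \<noteq> 0\<close>, of "M *v ?u"] assms
    by (simp add: invertible_mult_eq_0_iff rep_pplane_nonzero)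
qed

lemma projective_transformation_iff:
  "projective_transformation T \<longleftrightarrow> (\<exists>M. invertible M \<and> T = pmap M)"
proof
  assume "projective_transformation T"
  then obtain M where M: "invertible M" "\<And>v. v \<noteq> 0 \<Longrightarrow> T (proj v) = proj (M *v v)"
    by (auto simp: projective_transformation_def)
  have "T = pmap M"
  proof
    fix x show "T x = pmap M x"
      by (cases x rule: pplane_cases) (simp add: M pmap_proj)
  qed
  then show "\<exists>M. invertible M \<and> T = pmap M" using M by blast
qed (auto simp: projective_transformation_def pmap_proj)

lemma pmap_comp:
  assumes "invertible M" "invertible N" shows "pmap M (pmap N x) = pmap (M ** N) x"
  by (cases x rule: pplane_cases)
    (simp add: assms pmap_proj invertible_mult invertible_mult_eq_0_iff matrix_vector_mul_assoc)

lemma pmap_id: "pmap (mat 1) x = x"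
  by (cases x rule: pplane_cases) (simp add: pmap_proj invertible_def exI[of _ "mat 1"])

lemma projective_comp:
  "projective_transformation S \<Longrightarrow> projective_transformation T \<Longrightarrow> projective_transformation (S \<circ> T)"
  unfolding projective_transformation_iff
  by (metis (no_types, lifting) pmap_comp invertible_mult comp_apply ext)

lemma projective_inverse:
  assumes "projective_transformation S"
  obtains S' where "projective_transformation S'" "S \<circ> S' = id" "S' \<circ> S = id"
proof -
  obtain M where M: "invertible M" "S = pmap M" using assms projective_transformation_iff by blast
  then obtain N where N: "M ** N = mat 1" "N ** M = mat 1" by (auto simp: invertible_def)
  then have "invertible N" by (auto simp: invertible_def)
  then show ?thesis using M N that[of "pmap N"]
    by (auto simp: projective_transformation_iff pmap_comp pmap_id fun_eq_iff)
qed

lemma projective_inj: "projective_transformation S \<Longrightarrow> inj S"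
  by (metis projective_inverse inj_on_id inj_on_imageI2)

lemma pmap_image_locus:
  assumes "invertible M" "\<And>v. q v \<longleftrightarrow> q' (M *v v)"
  shows "pmap M ` locus q = locus q'"
proof
  show "pmap M ` locus q \<subseteq> locus q'"
    using assms by (auto simp: locus_def pmap_proj) (metis invertible_mult_eq_0_iff)
  show "locus q' \<subseteq> pmap M ` locus q"
  proof
    fix x assume "x \<in> locus q'"
    then obtain u where u: "u \<noteq> 0" "q' u" "x = proj u" by (auto simp: locus_def)
    obtain N where N: "M ** N = mat 1" using assms by (auto simp: invertible_def)
    have uN: "M *v (N *v u) = u" using N by (simp add: matrix_vector_mul_assoc)
    then have "N *v u \<noteq> 0" using u by auto
    then have "x = pmap M (proj (N *v u))" using assms u uN by (simp add: pmap_proj)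
    moreover have "proj (N *v u) \<in> locus q" 
      using \<open>N *v u \<noteq> 0\<close> uN u assms(2)[of "N *v u"] by (auto simp: locus_def)
    ultimately show "x \<in> pmap M ` locus q" by blast
  qed
qed

text \<open>Coefficient vectors transform by the inverse transpose of the matrix that moves the
  points.\<close>

lemma projective_is_line:
  assumes "projective_transformation S" "is_line L" shows "is_line (S ` L)"
proof -
  obtain M where M: "invertible M" "S = pmap M" using assms projective_transformation_iff by blast
  then obtain N where N: "M ** N = mat 1" "N ** M = mat 1" by (auto simp: invertible_def)
  obtain w where w: "w \<noteq> 0" "L = locus (\<lambda>v. w \<bullet> v = 0)" using assms is_line_iff by blast
  have "(transpose N *v w) \<bullet> (M *v v) = w \<bullet> (N *v (M *v v))" for v
    by (simp add: dot_lmul_matrix)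
  then have "w \<bullet> v = 0 \<longleftrightarrow> (transpose N *v w) \<bullet> (M *v v) = 0" for v
    using N by (simp add: matrix_vector_mul_assoc del: transpose_matrix_vector)
  then have "S ` L = locus (\<lambda>v. (transpose N *v w) \<bullet> v = 0)"
    unfolding M w by (intro pmap_image_locus M)
  moreover have "invertible N" using N by (auto simp: invertible_def)
  then have "invertible (transpose N)" by (rule transpose_invertible)
  ultimately show ?thesis using w is_line_iff invertible_mult_eq_0_iff by blast
qed

section \<open>Affine maps and standard quadrics\<close>

lemma mat3_vec:
  "(vector [vector [a,b,c], vector [d,e,f], vector [g,h,i]] :: real^3^3) *v v =
    vector [a * v$1 + b * v$2 + c * v$3, d * v$1 + e * v$2 + f * v$3, g * v$1 + h * v$2 + i * v$3]"
  by (simp add: vec3_eq_iff matrix_vector_mult_def sum_3)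

lemma mat3_invertible:
  "invertible (vector [vector [a,b,c], vector [d,e,f], vector [g,h,i]] :: real^3^3) \<longleftrightarrow>
    a * (e * i - f * h) - b * (d * i - f * g) + c * (d * h - e * g) \<noteq> 0"
  by (simp add: invertible_det_nz det_3 algebra_simps)

lemma mat3_expand:
  fixes M :: "real^3^3"
  obtains a b c d e f g h i
  where "M = vector [vector [a,b,c], vector [d,e,f], vector [g,h,i]]"
proof
  show "M = vector [vector [M$1$1, M$1$2, M$1$3], vector [M$2$1, M$2$2, M$2$3],
      vector [M$3$1, M$3$2, M$3$3]]"
    by (simp add: vec_eq_iff forall_3)
qed

lemma mat2_vec: "(A :: real^2^2) *v v =
    vector [A$1$1 * v$1 + A$1$2 * v$2, A$2$1 * v$1 + A$2$2 * v$2]"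
  by (simp add: vec2_eq_iff matrix_vector_mult_def sum_2)

lemma affine_imp_projective:
  assumes "affine_transformation T" shows "projective_transformation T"
proof -
  obtain A :: "real^2^2" and b where A: "invertible A" "\<And>p. T (aff p) = aff (A *v p + b)"
    "\<And>u. u \<noteq> 0 \<Longrightarrow> T (at_inf u) = at_inf (A *v u)"
    using assms by (auto simp: affine_transformation_def)
  define M :: "real^3^3" where
    "M = vector [vector [A$1$1, A$1$2, b$1], vector [A$2$1, A$2$2, b$2], vector [0, 0, 1]]"
  have inv: "invertible M"
    using A(1) unfolding M_def mat3_invertible by (simp add: invertible_det_nz det_2)
  have "T x = pmap M x" for x
  proof (cases x rule: pplane_affine_cases)
    case (finite p)
    have "pmap M x = proj (M *v vector [p$1, p$2, 1])"
      unfolding finite aff_def by (rule pmap_proj[OF inv aff_vec_nonzero])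
    also have "\<dots> = T x" unfolding finite A(2) by (simp add: aff_def M_def mat3_vec mat2_vec)
    finally show ?thesis ..
  next
    case (infinite u)
    have "pmap M x = proj (M *v vector [u$1, u$2, 0])"
      unfolding infinite(2) at_inf_def by (rule pmap_proj[OF inv at_inf_vec_nonzero[OF infinite(1)]])
    also have "\<dots> = T x" unfolding infinite(2) A(3)[OF infinite(1)]
      by (simp add: at_inf_def M_def mat3_vec mat2_vec)
    finally show ?thesis ..
  qed
  then show ?thesis using inv projective_transformation_iff by blast
qed

text \<open>Preserving the last coordinate 0 forces the last row of the matrix to be (0, 0, i) with
  \<open>i\<close> nonzero; dividing by \<open>i\<close> leaves a linear part and a
  translation.\<close>

lemma projective_imp_affine:
  assumes "projective_transformation T" "T ` line_at_infinity = line_at_infinity"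
  shows "affine_transformation T"
proof -
  obtain M where M: "invertible M" "T = pmap M" using assms projective_transformation_iff by blast
  obtain a b c d e f g h i
    where M_eq: "M = vector [vector [a,b,c], vector [d,e,f], vector [g,h,i]]"
    by (rule mat3_expand)
  have *: "(M *v v) $ 3 = 0" if "v \<noteq> 0" "v$3 = 0" for v
  proof -
    have "proj v \<in> line_at_infinity" using that by (auto simp: line_at_infinity_locus locus_def)
    then have "proj (M *v v) \<in> line_at_infinity"
      using assms(2) that M by (metis image_eqI pmap_proj)
    then show ?thesis
      using that M unfolding line_at_infinity_locus
      by (subst (asm) proj_mem_locus) (auto simp: invertible_mult_eq_0_iff)
  qed
  have g: "g = 0" "h = 0"
    using *[of "vector [1,0,0]"] *[of "vector [0,1,0]"] by (auto simp: M_eq mat3_vec vec3_eq_iff)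
  have det: "i \<noteq> 0" "a * e - b * d \<noteq> 0"
    using M(1) unfolding M_eq mat3_invertible g by (auto simp: algebra_simps)
  define A :: "real^2^2" where "A = vector [vector [a / i, b / i], vector [d / i, e / i]]"
  define p :: "real^2" where "p = vector [c / i, f / i]"
  have inv: "invertible A"
    using det by (simp add: invertible_det_nz det_2 A_def field_simps)
  have "T (aff q) = aff (A *v q + p)" for q
  proof -
    have "M *v vector [q$1, q$2, 1] = i *\<^sub>R vector [(A *v q + p)$1, (A *v q + p)$2, 1]"
      using det by (simp add: M_eq mat3_vec mat2_vec A_def p_def g vec3_eq_iff field_simps)
    then show ?thesis
      using det proj_scale[of i "vector [(A *v q + p)$1, (A *v q + p)$2, 1]"]
      by (simp add: M(2) aff_def pmap_proj[OF M(1) aff_vec_nonzero] aff_vec_nonzero)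
  qed
  moreover have "T (at_inf u) = at_inf (A *v u)" if "u \<noteq> 0" for u
  proof -
    have "A *v u \<noteq> 0" using inv that invertible_mult_eq_0_iff by blast
    have "M *v vector [u$1, u$2, 0] = i *\<^sub>R vector [(A *v u)$1, (A *v u)$2, 0]"
      using det by (simp add: M_eq mat3_vec mat2_vec A_def g vec3_eq_iff field_simps)
    then show ?thesis
      using det proj_scale[of i "vector [(A *v u)$1, (A *v u)$2, 0]"] \<open>A *v u \<noteq> 0\<close> that
      by (simp add: M(2) at_inf_def pmap_proj[OF M(1) at_inf_vec_nonzero] at_inf_vec_nonzero)
  qed
  ultimately show ?thesis using inv unfolding affine_transformation_def by blast
qed

section \<open>Conics as loci of quadratic forms\<close>

definition unit_circle :: "pplane set" where
  "unit_circle = locus (\<lambda>v. (v$1)\<^sup>2 + (v$2)\<^sup>2 = (v$3)\<^sup>2)"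

definition std_parabola :: "pplane set" where
  "std_parabola = locus (\<lambda>v. (v$1)\<^sup>2 = v$2 * v$3)"

definition std_hyperbola :: "pplane set" where
  "std_hyperbola = locus (\<lambda>v. v$1 * v$2 = (v$3)\<^sup>2)"

text \<open>The image of the projective line under (s : t) -> (s^2 : s t : t^2). It serves as the
  common model because a line cuts it where a binary quadratic form in (s, t) vanishes, and linear
  substitutions in (s, t) extend to projective maps of the plane.\<close>

definition veronese_conic :: "pplane set" where
  "veronese_conic = locus (\<lambda>v. v$1 * v$3 = (v$2)\<^sup>2)"

lemma circle_locus:
  "aff ` sphere c r = locus (\<lambda>v. (v$1 - c$1 * v$3)\<^sup>2 + (v$2 - c$2 * v$3)\<^sup>2 = r\<^sup>2 * (v$3)\<^sup>2)"
  (is "_ = locus ?q") if "r > 0"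
proof (rule set_eqI)
  have hom: "?q (k *\<^sub>R v) \<longleftrightarrow> ?q v" if "k \<noteq> 0" for k v
  proof -
    have "?q (k *\<^sub>R v) \<longleftrightarrow> k\<^sup>2 * ((v$1 - c$1 * v$3)\<^sup>2 + (v$2 - c$2 * v$3)\<^sup>2) = k\<^sup>2 * (r\<^sup>2 * (v$3)\<^sup>2)"
      by (simp add: power2_eq_square algebra_simps)
    then show ?thesis using that by simp
  qed
  fix x show "x \<in> aff ` sphere c r \<longleftrightarrow> x \<in> locus ?q"
  proof (cases x rule: pplane_affine_cases)
    case (finite p)
    have "x \<in> aff ` sphere c r \<longleftrightarrow> p \<in> sphere c r" using finite by (auto simp: aff_eq_iff)
    also have "\<dots> \<longleftrightarrow> (dist c p)\<^sup>2 = r\<^sup>2" using that by (simp add: power2_eq_iff_nonneg)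
    also have "\<dots> \<longleftrightarrow> x \<in> locus ?q" unfolding finite
      by (subst aff_mem_locus[OF hom]) (simp_all add: dist_vec_def L2_set_def sum_2 dist_real_def power2_commute)
    finally show ?thesis .
  next
    case (infinite u)
    then have "x \<notin> aff ` sphere c r" using aff_neq_at_inf by force
    moreover have "x \<notin> locus ?q" unfolding infinite
      by (subst at_inf_mem_locus[OF infinite(1) hom])
        (use infinite in \<open>auto simp: vec2_eq_iff sum_power2_eq_zero_iff\<close>)
    ultimately show ?thesis by blast
  qed
qed

lemma unit_circle_eq: "unit_circle = aff ` sphere 0 1"
  using circle_locus[of 1 0] by (simp add: unit_circle_def)

lemma parabola_eq:
  "aff ` {p. p$2 = (p$1)\<^sup>2} \<union> {at_inf (vector [0, 1])} = std_parabola" (is "?P = _")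
proof (rule set_eqI)
  have hom: "(k *\<^sub>R v :: real^3)$1 ^ 2 = (k *\<^sub>R v)$2 * (k *\<^sub>R v)$3 \<longleftrightarrow> (v$1)\<^sup>2 = v$2 * v$3"
    if "k \<noteq> 0" for k v using that by (simp add: power2_eq_square)
  fix x show "x \<in> ?P \<longleftrightarrow> x \<in> std_parabola"
  proof (cases x rule: pplane_affine_cases)
    case (finite p)
    moreover have "aff p \<noteq> at_inf (vector [0, 1])"
      by (rule aff_neq_at_inf) (simp add: vec2_eq_iff)
    ultimately show ?thesis unfolding std_parabola_def finite
      by (subst aff_mem_locus[OF hom]) (auto simp: aff_eq_iff)
  next
    case (infinite u)
    have "x \<in> ?P \<longleftrightarrow> at_inf (vector [0, 1]) = at_inf u"
      using infinite aff_neq_at_inf[OF infinite(1)] by (auto, metis)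
    also have "\<dots> \<longleftrightarrow> u$1 = 0" using infinite
      by (subst at_inf_eq_iff) (auto simp: vec2_eq_iff)
    also have "\<dots> \<longleftrightarrow> x \<in> std_parabola" unfolding std_parabola_def infinite
      by (subst at_inf_mem_locus[OF infinite(1) hom]) auto
    finally show ?thesis .
  qed
qed

lemma hyperbola_eq:
  "aff ` {p. p$1 * p$2 = 1} \<union> {at_inf (vector [1, 0]), at_inf (vector [0, 1])} = std_hyperbola"
  (is "?P = _")
proof (rule set_eqI)
  have hom: "(k *\<^sub>R v :: real^3)$1 * (k *\<^sub>R v)$2 = ((k *\<^sub>R v)$3)\<^sup>2 \<longleftrightarrow> v$1 * v$2 = (v$3)\<^sup>2"
    if "k \<noteq> 0" for k v using that by (simp add: power2_eq_square)
  fix x show "x \<in> ?P \<longleftrightarrow> x \<in> std_hyperbola"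
  proof (cases x rule: pplane_affine_cases)
    case (finite p)
    moreover have "aff p \<noteq> at_inf (vector [0, 1])" "aff p \<noteq> at_inf (vector [1, 0])"
      by (rule aff_neq_at_inf, simp add: vec2_eq_iff)+
    ultimately show ?thesis unfolding std_hyperbola_def finite
      by (subst aff_mem_locus[OF hom]) (auto simp: aff_eq_iff)
  next
    case (infinite u)
    have "x \<in> ?P \<longleftrightarrow> at_inf (vector [0, 1]) = at_inf u \<or> at_inf (vector [1, 0]) = at_inf u"
      using infinite aff_neq_at_inf[OF infinite(1)] by (auto, metis+)
    also have "\<dots> \<longleftrightarrow> u$1 = 0 \<or> u$2 = 0" using infinite
        at_inf_eq_iff[of "vector [0, 1]" u] at_inf_eq_iff[of "vector [1, 0]" u]
      by (auto simp: vec2_eq_iff)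
    also have "\<dots> \<longleftrightarrow> x \<in> std_hyperbola" unfolding std_hyperbola_def infinite
      by (subst at_inf_mem_locus[OF infinite(1) hom]) auto
    finally show ?thesis .
  qed
qed

lemma quadric_veronese:
  assumes "is_quadric Q"
  obtains T where "projective_transformation T" "Q = T ` veronese_conic"
proof -
  have "\<exists>T S. projective_transformation T \<and> projective_transformation S \<and> Q = T ` S ` veronese_conic"
    using assms unfolding is_quadric_def
  proof (elim disjE)
    assume "is_ellipse Q"
    then obtain T c r where T: "affine_transformation T" "r > 0" "Q = T ` aff ` sphere c r"
      by (auto simp: is_ellipse_def is_circle_def)
    \<comment> \<open>On (s^2, s t, t^2) this is the rational parametrization c + r ((s^2 - t^2, 2 s
      t) / (s^2 + t^2)) of the circle.\<close>
    define M :: "real^3^3" where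
      "M = vector [vector [r + c$1, 0, c$1 - r], vector [c$2, 2 * r, c$2], vector [1, 0, 1]]"
    have inv: "invertible M" using T by (simp add: M_def mat3_invertible)
    have "pmap M ` veronese_conic = aff ` sphere c r"
      unfolding circle_locus[OF T(2)] veronese_conic_def
    proof (rule pmap_image_locus[OF inv])
      fix v :: "real^3"
      have "((M *v v)$1 - c$1 * (M *v v)$3)\<^sup>2 + ((M *v v)$2 - c$2 * (M *v v)$3)\<^sup>2 -
          r\<^sup>2 * ((M *v v)$3)\<^sup>2 = - 4 * r\<^sup>2 * (v$1 * v$3 - (v$2)\<^sup>2)"
        by (simp add: M_def mat3_vec algebra_simps power2_eq_square)
      then show "v$1 * v$3 = (v$2)\<^sup>2 \<longleftrightarrow> ((M *v v)$1 - c$1 * (M *v v)$3)\<^sup>2 +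
          ((M *v v)$2 - c$2 * (M *v v)$3)\<^sup>2 = r\<^sup>2 * ((M *v v)$3)\<^sup>2"
        using T(2) by (smt (verit) mult_eq_0_iff zero_less_power)
    qed
    then show ?thesis
      using affine_imp_projective[OF T(1)] T(3) inv projective_transformation_iff by metis
  next
    assume "is_parabola Q"
    then obtain T where T: "affine_transformation T" "Q = T ` std_parabola"
      unfolding is_parabola_def parabola_eq by blast
    define M :: "real^3^3" where "M = vector [vector [0, 1, 0], vector [1, 0, 0], vector [0, 0, 1]]"
    have inv: "invertible M" using T by (simp add: M_def mat3_invertible)
    have "pmap M ` veronese_conic = std_parabola"
      unfolding std_parabola_def veronese_conic_def
      by (rule pmap_image_locus[OF inv]) (auto simp: M_def mat3_vec)
    then show ?thesis
      using affine_imp_projective[OF T(1)] T(2) inv projective_transformation_iff by metis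
  next
    assume "is_hyperbola Q"
    then obtain T where T: "affine_transformation T" "Q = T ` std_hyperbola"
      unfolding is_hyperbola_def hyperbola_eq by blast
    define M :: "real^3^3" where "M = vector [vector [1, 0, 0], vector [0, 0, 1], vector [0, 1, 0]]"
    have inv: "invertible M" using T by (simp add: M_def mat3_invertible)
    have "pmap M ` veronese_conic = std_hyperbola"
      unfolding std_hyperbola_def veronese_conic_def
      by (rule pmap_image_locus[OF inv]) (auto simp: M_def mat3_vec)
    then show ?thesis
      using affine_imp_projective[OF T(1)] T(2) inv projective_transformation_iff by metis
  qed
  then show ?thesis using that projective_comp by (metis image_comp)
qed

section \<open>Normal form of a quadric and a line\<close>

text \<open>The triple (a, b, c) stands for the form a X^2 + b X Y + c Y^2. Up to the factor
  \<open>k\<close>, which also absorbs a sign, it is f^2 + g^2, f g or g^2 for the independent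
  linear forms f = p X + q Y and g = r X + s Y, depending on the sign of the discriminant.\<close>

lemma binary_form_cases:
  fixes a b c :: real
  assumes "a \<noteq> 0 \<or> b \<noteq> 0 \<or> c \<noteq> 0"
  obtains p q r s k where "p * s - q * r \<noteq> 0" "k \<noteq> 0"
    "(k * a, k * b, k * c) = (p\<^sup>2 + r\<^sup>2, 2 * p * q + 2 * r * s, q\<^sup>2 + s\<^sup>2) \<or>
     (k * a, k * b, k * c) = (p * r, p * s + q * r, q * s) \<or>
     (k * a, k * b, k * c) = (r\<^sup>2, 2 * r * s, s\<^sup>2)"
proof -
  define d where "d = b\<^sup>2 - 4 * a * c"
  consider "d < 0" | "d = 0" "a = 0" | "d = 0" "a \<noteq> 0" | "d > 0" "a = 0" | "d > 0" "a \<noteq> 0"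
    by linarith
  then show ?thesis
  proof cases
    case 1
    have "a \<noteq> 0" using 1 by (auto simp: d_def)
    have "(sqrt (- d) / 2)\<^sup>2 = - d / 4" using 1 by (simp add: power_divide)
    \<comment> \<open>Completing the square: a (a X^2 + b X Y + c Y^2) = (a X + (b/2) Y)^2 - (d/4)
      Y^2. The witnesses are listed in the order \<open>p\<close>, \<open>s\<close>,
      \<open>q\<close>, \<open>r\<close>, \<open>k\<close>, here and in the other cases.\<close>
    then show ?thesis
      using that[of a "sqrt (- d) / 2" "b / 2" 0 a] \<open>a \<noteq> 0\<close> 1
      by (simp add: d_def power2_eq_square field_simps)
  next
    case 2
    then have "b = 0" "c \<noteq> 0" using assms by (auto simp: d_def)
    then show ?thesis using that[of 1 c 0 0 c] 2 by (simp add: power2_eq_square)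
  next
    case 3
    \<comment> \<open>With d = 0, the form times 4a is (2a X + b Y)^2; the other linear form only
      has to be independent of this one.\<close>
    then show ?thesis using that[of 0 b 1 "2 * a" "4 * a"]
      by (simp add: d_def power2_eq_square algebra_simps)
  next
    case 4
    then have "b \<noteq> 0" by (auto simp: d_def)
    then show ?thesis using that[of 0 c 1 b 1] 4 by simp
  next
    case 5
    have "(sqrt d)\<^sup>2 = d" using 5 by simp
    \<comment> \<open>The form times 4a factors as (2a X + (b + sqrt d) Y) (2a X + (b - sqrt d)
      Y).\<close>
    then show ?thesis using that[of "2 * a" "b - sqrt d" "b + sqrt d" "2 * a" "4 * a"] 5
      by (simp add: d_def power2_eq_square algebra_simps)
  qed
qed

text \<open>The symmetric square of the substitution \<open>(s, t) \<mapsto> (p s + q t, r s + u t)\<close>, acting on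
  \<open>(s\<^sup>2, s t, t\<^sup>2)\<close>.\<close>

definition sym_square :: "real \<Rightarrow> real \<Rightarrow> real \<Rightarrow> real \<Rightarrow> real^3^3" where
  "sym_square p q r u = vector [vector [p\<^sup>2, 2 * p * q, q\<^sup>2],
     vector [p * r, p * u + q * r, q * u], vector [r\<^sup>2, 2 * r * u, u\<^sup>2]]"

lemma sym_square_invertible:
  assumes "p * u - q * r \<noteq> 0" shows "invertible (sym_square p q r u)"
proof -
  \<comment> \<open>The determinant of a symmetric square is the cube of the determinant of the
    substitution.\<close>
  have "(p * u - q * r) ^ 3 \<noteq> 0" using assms by simp
  also have "(p * u - q * r) ^ 3 = p\<^sup>2 * ((p * u + q * r) * u\<^sup>2 - q * u * (2 * r * u)) -
    2 * p * q * (p * r * u\<^sup>2 - q * u * r\<^sup>2) + q\<^sup>2 * (p * r * (2 * r * u) - (p * u + q * r) * r\<^sup>2)"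
    by (simp add: power2_eq_square power3_eq_cube algebra_simps)
  finally show ?thesis unfolding sym_square_def mat3_invertible .
qed

text \<open>Read v as the symmetric 2x2 matrix with rows (v1, v2) and (v2, v3). Then
  \<open>sym_square\<close> acts by congruence, which multiplies its determinant v1 v3 - v2^2 by the
  square of the determinant of the substitution.\<close>

lemma sym_square_veronese:
  "(sym_square p q r u *v v)$1 * (sym_square p q r u *v v)$3 - ((sym_square p q r u *v v)$2)\<^sup>2 =
    (p * u - q * r)\<^sup>2 * (v$1 * v$3 - (v$2)\<^sup>2)"
  by (simp add: sym_square_def mat3_vec power2_eq_square algebra_simps)

lemma quadric_line_normal_form:
  assumes "is_quadric Q" "is_line l"
  obtains S where "projective_transformation S" "S ` l = line_at_infinity"
    "S ` Q = unit_circle \<or> S ` Q = std_parabola \<or> S ` Q = std_hyperbola"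
proof -
  obtain T where T: "projective_transformation T" "Q = T ` veronese_conic"
    using quadric_veronese assms by blast
  obtain T' where T': "projective_transformation T'" "T' \<circ> T = id"
    using projective_inverse T by blast
  have Q': "T' ` Q = veronese_conic" unfolding T(2) image_comp T' by simp
  have "is_line (T' ` l)" using T' assms projective_is_line by blast
  then obtain w where w: "w \<noteq> 0" "T' ` l = locus (\<lambda>v. w \<bullet> v = 0)" using is_line_iff by blast
  have "w$1 \<noteq> 0 \<or> w$2 \<noteq> 0 \<or> w$3 \<noteq> 0" using w by (auto simp: vec3_eq_iff)
  then obtain p q r u k where pqru: "p * u - q * r \<noteq> 0" and "k \<noteq> 0" and
    k: "(k * w$1, k * w$2, k * w$3) = (p\<^sup>2 + r\<^sup>2, 2 * p * q + 2 * r * u, q\<^sup>2 + u\<^sup>2) \<or>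
     (k * w$1, k * w$2, k * w$3) = (p * r, p * u + q * r, q * u) \<or>
     (k * w$1, k * w$2, k * w$3) = (r\<^sup>2, 2 * r * u, u\<^sup>2)"
    using binary_form_cases by metis
  define N where "N = sym_square p q r u"
  have N: "invertible N" using sym_square_invertible[OF pqru] by (simp add: N_def)
  have ver: "v$1 * v$3 = (v$2)\<^sup>2 \<longleftrightarrow> (N *v v)$1 * (N *v v)$3 = ((N *v v)$2)\<^sup>2" for v
    using sym_square_veronese[of p q r u v] pqru unfolding N_def[symmetric]
    by (smt (verit) mult_eq_0_iff power2_eq_square)
  have line: "w \<bullet> v = 0 \<longleftrightarrow> k * w$1 * v$1 + k * w$2 * v$2 + k * w$3 * v$3 = 0" for v
  proof -
    have "k * w$1 * v$1 + k * w$2 * v$2 + k * w$3 * v$3 = k * (w \<bullet> v)"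
      by (simp add: inner_3 algebra_simps)
    then show ?thesis using \<open>k \<noteq> 0\<close> by simp
  qed
  have "\<exists>M. invertible M \<and> pmap M ` T' ` l = line_at_infinity \<and>
    (pmap M ` T' ` Q = unit_circle \<or> pmap M ` T' ` Q = std_parabola \<or> pmap M ` T' ` Q = std_hyperbola)"
    using k
  proof (elim disjE)
    assume k: "(k * w$1, k * w$2, k * w$3) = (p\<^sup>2 + r\<^sup>2, 2 * p * q + 2 * r * u, q\<^sup>2 + u\<^sup>2)"
    \<comment> \<open>With X = p s + q t and Y = r s + u t, \<open>N\<close> yields (X^2, X Y, Y^2).
      In each of the three cases the last row of \<open>P\<close> produces the form that cuts out
      the line, here X^2 + Y^2, so that the line goes to infinity; the other rows complete the
      equation of the normal form.\<close>
    define P :: "real^3^3" where "P = vector [vector [1, 0, -1], vector [0, 2, 0], vector [1, 0, 1]]"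
    have inv: "invertible (P ** N)" using N by (simp add: P_def mat3_invertible invertible_mult)
    have "pmap (P ** N) ` veronese_conic = unit_circle" unfolding veronese_conic_def unit_circle_def
      by (rule pmap_image_locus[OF inv], subst ver)
        (auto simp add: P_def mat3_vec power2_eq_square algebra_simps simp flip: matrix_vector_mul_assoc)
    moreover have "pmap (P ** N) ` T' ` l = line_at_infinity" unfolding w line_at_infinity_locus
      by (rule pmap_image_locus[OF inv], subst line)
        (use k in \<open>simp add: P_def N_def sym_square_def mat3_vec algebra_simps flip: matrix_vector_mul_assoc\<close>)
    ultimately show ?thesis using inv Q' by metis
  next
    assume k: "(k * w$1, k * w$2, k * w$3) = (p * r, p * u + q * r, q * u)"
    define P :: "real^3^3" where "P = vector [vector [1, 0, 0], vector [0, 0, 1], vector [0, 1, 0]]"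
    have inv: "invertible (P ** N)" using N by (simp add: P_def mat3_invertible invertible_mult)
    have "pmap (P ** N) ` veronese_conic = std_hyperbola" unfolding veronese_conic_def std_hyperbola_def
      by (rule pmap_image_locus[OF inv], subst ver)
        (simp add: P_def mat3_vec flip: matrix_vector_mul_assoc)
    moreover have "pmap (P ** N) ` T' ` l = line_at_infinity" unfolding w line_at_infinity_locus
      by (rule pmap_image_locus[OF inv], subst line)
        (use k in \<open>simp add: P_def N_def sym_square_def mat3_vec flip: matrix_vector_mul_assoc\<close>)
    ultimately show ?thesis using inv Q' by metis
  next
    assume k: "(k * w$1, k * w$2, k * w$3) = (r\<^sup>2, 2 * r * u, u\<^sup>2)"
    define P :: "real^3^3" where "P = vector [vector [0, 1, 0], vector [1, 0, 0], vector [0, 0, 1]]"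
    have inv: "invertible (P ** N)" using N by (simp add: P_def mat3_invertible invertible_mult)
    have "pmap (P ** N) ` veronese_conic = std_parabola" unfolding veronese_conic_def std_parabola_def
      by (rule pmap_image_locus[OF inv], subst ver)
        (auto simp add: P_def mat3_vec simp flip: matrix_vector_mul_assoc)
    moreover have "pmap (P ** N) ` T' ` l = line_at_infinity" unfolding w line_at_infinity_locus
      by (rule pmap_image_locus[OF inv], subst line)
        (use k in \<open>simp add: P_def N_def sym_square_def mat3_vec flip: matrix_vector_mul_assoc\<close>)
    ultimately show ?thesis using inv Q' by metis
  qed
  then obtain M where M: "invertible M" "pmap M ` T' ` l = line_at_infinity"
    "pmap M ` T' ` Q = unit_circle \<or> pmap M ` T' ` Q = std_parabola \<or> pmap M ` T' ` Q = std_hyperbola"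
    by blast
  then show ?thesis using that[of "pmap M \<circ> T'"] T'(1)
    by (metis image_comp projective_comp projective_transformation_iff)
qed

section \<open>General position and its validity on quadrics\<close>

lemma general_position_subset: "general_position S \<Longrightarrow> S' \<subseteq> S \<Longrightarrow> general_position S'"
  unfolding general_position_def by blast

lemma general_positionD:
  "general_position S \<Longrightarrow> is_line L \<Longrightarrow> p \<in> S \<Longrightarrow> q \<in> S \<Longrightarrow> r \<in> S \<Longrightarrow>
    p \<in> L \<Longrightarrow> q \<in> L \<Longrightarrow> r \<in> L \<Longrightarrow> p = q \<or> p = r \<or> q = r"
  unfolding general_position_def by blast

lemma general_position_image:
  assumes "projective_transformation T" "general_position S"
  shows "general_position (T ` S)"
  unfolding general_position_def
proof (intro ballI impI notI)
  fix p q r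
  assume pqr: "p \<in> T ` S" "q \<in> T ` S" "r \<in> T ` S" "p \<noteq> q \<and> p \<noteq> r \<and> q \<noteq> r"
    and "\<exists>L. is_line L \<and> p \<in> L \<and> q \<in> L \<and> r \<in> L"
  then obtain L where L: "is_line L" "p \<in> L" "q \<in> L" "r \<in> L" by blast
  obtain T' where T': "projective_transformation T'" "T' \<circ> T = id" "T \<circ> T' = id"
    using projective_inverse assms by blast
  have pull: "T' x \<in> S" if "x \<in> T ` S" for x using that T'(2) by (auto simp: fun_eq_iff)
  have "T' p = T' q \<or> T' p = T' r \<or> T' q = T' r"
    using general_positionD[OF assms(2) projective_is_line[OF T'(1) L(1)]] pull pqr L by blast
  then show False using pqr T'(3) unfolding fun_eq_iff comp_def id_def by metis
qed

lemma veronese_conic_proj: "v \<noteq> 0 \<Longrightarrow> proj v \<in> veronese_conic \<longleftrightarrow> v$1 * v$3 = (v$2)\<^sup>2"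
  unfolding veronese_conic_def by (rule proj_mem_locus) (auto simp: power2_eq_square)

text \<open>A line meets the conic at the zeros of a binary quadratic form. Three distinct zeros
  would annihilate \<open>w\<close> by a Vandermonde-like matrix, whose determinant is the product
  of the pairwise minors s t' - s' t.\<close>

lemma general_position_veronese: "general_position veronese_conic"
  unfolding general_position_def
proof (intro ballI impI notI)
  fix x y z
  assume xyz: "x \<in> veronese_conic" "y \<in> veronese_conic" "z \<in> veronese_conic"
      "x \<noteq> y \<and> x \<noteq> z \<and> y \<noteq> z"
    and "\<exists>L. is_line L \<and> x \<in> L \<and> y \<in> L \<and> z \<in> L"
  then obtain w where w: "w \<noteq> 0" and inL: "x \<in> locus (\<lambda>v. w \<bullet> v = 0)"
      "y \<in> locus (\<lambda>v. w \<bullet> v = 0)" "z \<in> locus (\<lambda>v. w \<bullet> v = 0)"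
    by (auto simp: is_line_iff)
  have param: "\<exists>s t. (s \<noteq> 0 \<or> t \<noteq> 0) \<and> p = proj (vector [s\<^sup>2, s * t, t\<^sup>2]) \<and>
      w$1 * s\<^sup>2 + w$2 * s * t + w$3 * t\<^sup>2 = 0"
    if p: "p \<in> veronese_conic" "p \<in> locus (\<lambda>v. w \<bullet> v = 0)" for p
  proof -
    obtain v where v: "v \<noteq> 0" "p = proj v" by (rule pplane_cases)
    have eq: "v$1 * v$3 = (v$2)\<^sup>2" "w$1 * v$1 + w$2 * v$2 + w$3 * v$3 = 0"
      using p v veronese_conic_proj proj_mem_line[of v w] by (auto simp: inner_3)
    show ?thesis
    proof (cases "v$1 = 0")
      case True
      then have "v$2 = 0" "v$3 \<noteq> 0" using eq v by (auto simp: vec3_eq_iff)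
      then have "vector [0, 0, 1] = (1 / v$3) *\<^sub>R v" using True by (simp add: vec3_eq_iff)
      then have "p = proj (vector [0, 0, 1])"
        using v \<open>v$3 \<noteq> 0\<close> proj_scale[of "1 / v$3" v] by simp
      then show ?thesis using True eq \<open>v$2 = 0\<close> \<open>v$3 \<noteq> 0\<close>
        by (intro exI[of _ 0] exI[of _ 1]) simp
    next
      case False
      \<comment> \<open>Scaling a representative by its first coordinate brings it to the form (s^2,
        s t, t^2) with s = v1 and t = v2.\<close>
      have "vector [(v$1)\<^sup>2, v$1 * v$2, (v$2)\<^sup>2] = v$1 *\<^sub>R v"
        using eq by (simp add: vec3_eq_iff power2_eq_square)
      then have "p = proj (vector [(v$1)\<^sup>2, v$1 * v$2, (v$2)\<^sup>2])"
        using v False proj_scale[of "v$1" v] by simp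
      moreover have "w$1 * (v$1)\<^sup>2 + w$2 * v$1 * v$2 + w$3 * (v$2)\<^sup>2 =
          v$1 * (w$1 * v$1 + w$2 * v$2 + w$3 * v$3)"
        using eq(1)[symmetric] by (simp add: power2_eq_square algebra_simps)
      ultimately show ?thesis using False eq(2)
        by (intro exI[of _ "v$1"] exI[of _ "v$2"]) simp
    qed
  qed
  obtain s1 t1 where 1: "s1 \<noteq> 0 \<or> t1 \<noteq> 0" "x = proj (vector [s1\<^sup>2, s1 * t1, t1\<^sup>2])"
      "w$1 * s1\<^sup>2 + w$2 * s1 * t1 + w$3 * t1\<^sup>2 = 0" using param[OF xyz(1) inL(1)] by blast
  obtain s2 t2 where 2: "s2 \<noteq> 0 \<or> t2 \<noteq> 0" "y = proj (vector [s2\<^sup>2, s2 * t2, t2\<^sup>2])"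
      "w$1 * s2\<^sup>2 + w$2 * s2 * t2 + w$3 * t2\<^sup>2 = 0" using param[OF xyz(2) inL(2)] by blast
  obtain s3 t3 where 3: "s3 \<noteq> 0 \<or> t3 \<noteq> 0" "z = proj (vector [s3\<^sup>2, s3 * t3, t3\<^sup>2])"
      "w$1 * s3\<^sup>2 + w$2 * s3 * t3 + w$3 * t3\<^sup>2 = 0" using param[OF xyz(3) inL(3)] by blast
  have indep: "s * t' - s' * t \<noteq> 0"
    if ne: "s \<noteq> 0 \<or> t \<noteq> 0" "s' \<noteq> 0 \<or> t' \<noteq> 0"
      "proj (vector [s\<^sup>2, s * t, t\<^sup>2]) \<noteq> proj (vector [s'\<^sup>2, s' * t', t'\<^sup>2])" for s t s' t' :: real
  proof
    assume 0: "s * t' - s' * t = 0"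
    obtain k where k: "s' = k * s" "t' = k * t"
    proof (cases "s = 0")
      case True then show ?thesis using 0 ne(1) by (intro that(1)[of "t' / t"]) auto
    next
      case False then show ?thesis using 0 by (intro that(1)[of "s' / s"]) (auto simp: field_simps)
    qed
    have "vector [s'\<^sup>2, s' * t', t'\<^sup>2] = k\<^sup>2 *\<^sub>R (vector [s\<^sup>2, s * t, t\<^sup>2] :: real^3)"
      by (simp add: k vec3_eq_iff power2_eq_square)
    moreover have "k \<noteq> 0" using k ne by auto
    moreover have "vector [s\<^sup>2, s * t, t\<^sup>2] \<noteq> (0 :: real^3)" using ne by (auto simp: vec3_eq_iff)
    ultimately show False using ne(3) proj_scale[of "k\<^sup>2" "vector [s\<^sup>2, s * t, t\<^sup>2]"] by simp
  qed
  have d: "s1 * t2 - s2 * t1 \<noteq> 0" "s1 * t3 - s3 * t1 \<noteq> 0" "s2 * t3 - s3 * t2 \<noteq> 0"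
    using indep 1 2 3 xyz(4) by auto
  have "invertible (vector [vector [s1\<^sup>2, s1 * t1, t1\<^sup>2], vector [s2\<^sup>2, s2 * t2, t2\<^sup>2],
      vector [s3\<^sup>2, s3 * t3, t3\<^sup>2]] :: real^3^3)" (is "invertible ?V")
  proof -
    have "(s1 * t2 - s2 * t1) * (s1 * t3 - s3 * t1) * (s2 * t3 - s3 * t2) \<noteq> 0" using d by simp
    also have "(s1 * t2 - s2 * t1) * (s1 * t3 - s3 * t1) * (s2 * t3 - s3 * t2) =
      s1\<^sup>2 * (s2 * t2 * t3\<^sup>2 - t2\<^sup>2 * (s3 * t3)) - s1 * t1 * (s2\<^sup>2 * t3\<^sup>2 - t2\<^sup>2 * s3\<^sup>2) +
      t1\<^sup>2 * (s2\<^sup>2 * (s3 * t3) - s2 * t2 * s3\<^sup>2)"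
      by (simp add: power2_eq_square algebra_simps)
    finally show ?thesis unfolding mat3_invertible .
  qed
  moreover have "?V *v w = 0" using 1 2 3 by (simp add: mat3_vec vec3_eq_iff algebra_simps)
  ultimately show False using w invertible_mult_eq_0_iff by blast
qed

lemma general_position_quadric: "is_quadric Q \<Longrightarrow> general_position Q"
  by (metis quadric_veronese general_position_image general_position_veronese)

section \<open>Small product sets\<close>

text \<open>For d = x / x' with x and x' in X, the sets x Y and x' Y both lie in the product set, so
  they overlap in more than n/2 elements, and each common element x y = x' y' exhibits d as y' / y.
  Thus every quotient from one set has more than n/2 representations in the other, and
  \<open>H\<close> is the set of quotients of either.\<close>

lemma small_product_set:
  fixes A B :: "'a::field set"
  assumes fin: "finite A" "finite B" and card: "card A = n" "card B = n" "n > 0"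
    and nz: "0 \<notin> A" "0 \<notin> B"
    and small: "2 * card ((\<lambda>(a, b). a * b) ` (A \<times> B)) < 3 * n"
  obtains H where "finite H" "0 \<notin> H" "1 \<in> H" "\<And>x y. x \<in> H \<Longrightarrow> y \<in> H \<Longrightarrow> x / y \<in> H"
    "card H \<le> card ((\<lambda>(a, b). a * b) ` (A \<times> B))"
    "\<And>a a'. a \<in> A \<Longrightarrow> a' \<in> A \<Longrightarrow> a / a' \<in> H"
    "\<And>b b'. b \<in> B \<Longrightarrow> b' \<in> B \<Longrightarrow> b / b' \<in> H"
proof -
  have many: "2 * card {y \<in> Y. d * y \<in> Y} > n"
    if X: "finite X" "finite Y" "card X = n" "card Y = n" "0 \<notin> X" "0 \<notin> Y"
      "2 * card ((\<lambda>(a, b). a * b) ` (X \<times> Y)) < 3 * n"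
      and d: "x \<in> X" "x' \<in> X" "d = x / x'" for X Y :: "'a set" and x x' d
  proof -
    let ?P = "(\<lambda>(a, b). a * b) ` (X \<times> Y)"
    have nz: "x \<noteq> 0" "x' \<noteq> 0" using X d by auto
    have "finite ?P" using X by simp
    have c: "card (times x ` Y) = n" "card (times x' ` Y) = n"
      using nz X by (auto simp: card_image inj_on_def)
    have "card (times x ` Y \<union> times x' ` Y) \<le> card ?P"
      using d \<open>finite ?P\<close> by (intro card_mono) auto
    moreover have "card (times x ` Y) + card (times x' ` Y) =
        card (times x ` Y \<union> times x' ` Y) + card (times x ` Y \<inter> times x' ` Y)"
      using X by (intro card_Un_Int) auto
    ultimately have "2 * card (times x ` Y \<inter> times x' ` Y) > n" using X(7) c by linarith
    moreover have "times x ` Y \<inter> times x' ` Y \<subseteq> times x ` {y \<in> Y. d * y \<in> Y}"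
    proof
      fix z assume "z \<in> times x ` Y \<inter> times x' ` Y"
      then obtain y y' where y: "y \<in> Y" "y' \<in> Y" "z = x * y" "z = x' * y'" by auto
      have "x' * (d * y) = (x' * d) * y" by (simp only: mult.assoc)
      also have "x' * d = x" using d(3) nz by simp
      also have "x * y = x' * y'" using y by simp
      finally have "d * y = y'" using mult_left_cancel[OF nz(2)] by blast
      then show "z \<in> times x ` {y \<in> Y. d * y \<in> Y}" using y by auto
    qed
    then have "card (times x ` Y \<inter> times x' ` Y) \<le> card (times x ` {y \<in> Y. d * y \<in> Y})"
      using X by (intro card_mono) auto
    moreover have "card (times x ` {y \<in> Y. d * y \<in> Y}) \<le> card {y \<in> Y. d * y \<in> Y}"
      using X by (intro card_image_le) auto
    ultimately show ?thesis by linarith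
  qed
  have swap: "(\<lambda>(a, b). a * b) ` (B \<times> A) = (\<lambda>(a, b). a * b) ` (A \<times> B)"
    by (auto simp: image_def mult.commute) (metis mult.commute)+
  define H where "H = (\<lambda>(b, b'). b / b') ` (B \<times> B)"
  have quot: "\<exists>y\<in>Y. d * y \<in> Y" if "2 * card {y \<in> Y. d * y \<in> Y} > n" for Y and d :: 'a
  proof -
    have "{y \<in> Y. d * y \<in> Y} \<noteq> {}" using that by (metis card.empty mult_0_right not_less_zero)
    then show ?thesis by blast
  qed
  have memH: "d \<in> H" if "y \<in> B" "d * y \<in> B" for d y
    using that nz unfolding H_def by (intro image_eqI[of _ _ "(d * y, y)"]) auto
  have AH: "a / a' \<in> H" if "a \<in> A" "a' \<in> A" for a a'
    using quot[OF many[OF fin card(1,2) nz small that refl]] memH by blast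
  \<comment> \<open>\<open>many\<close> turns a quotient from one set into many from the other. To
    count representations in \<open>B\<close> of an element of \<open>H\<close>, that element must
    first be recognized as a quotient from \<open>A\<close>.\<close>
  have HA: "\<exists>a\<in>A. \<exists>a'\<in>A. d = a / a'" if d: "d \<in> H" for d
  proof -
    obtain b b' where b: "b \<in> B" "b' \<in> B" "d = b / b'" using d by (auto simp: H_def)
    obtain a where "a \<in> A" "d * a \<in> A"
      using quot[OF many[OF fin(2,1) card(2,1) nz(2,1) _ b]] small unfolding swap by blast
    then show ?thesis using nz by (intro bexI[of _ "d * a"] bexI[of _ a]) auto
  qed
  have manyH: "2 * card {y \<in> B. d * y \<in> B} > n" if "d \<in> H" for d
    using HA[OF that] many[OF fin card(1,2) nz small] by blast
  have finH: "finite H" using fin by (simp add: H_def)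
  \<comment> \<open>The sets of b in \<open>B\<close> with x b in \<open>B\<close> and with y b in
    \<open>B\<close> each exceed n/2, so they share some b, and x / y = (x b) / (y b).\<close>
  have div: "x / y \<in> H" if xy: "x \<in> H" "y \<in> H" for x y
  proof -
    let ?X = "{b \<in> B. x * b \<in> B}" and ?Y = "{b \<in> B. y * b \<in> B}"
    have "card (?X \<union> ?Y) \<le> card B" using fin by (intro card_mono) auto
    moreover have "card ?X + card ?Y = card (?X \<union> ?Y) + card (?X \<inter> ?Y)"
      using fin by (intro card_Un_Int) auto
    ultimately have "card (?X \<inter> ?Y) > 0" using manyH[OF xy(1)] manyH[OF xy(2)] card by linarith
    then obtain b where b: "b \<in> B" "x * b \<in> B" "y * b \<in> B" by (auto simp: card_gt_0_iff)
    have "y \<noteq> 0" using b nz by auto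
    then show ?thesis using b memH[of "y * b" "x / y"] by simp
  qed
  \<comment> \<open>Double counting: each element of \<open>H\<close> claims at least (n + 1)/2 of
    the n^2 pairs from \<open>B\<close>. The 1 gained from the strict inequality makes the resulting
    bound \<open>card H < 2 * n\<close> strict.\<close>
  have "card H * (n + 1) \<le> 2 * (n * n)"
  proof -
    have "(\<Sum>d\<in>H. n + 1) \<le> (\<Sum>d\<in>H. 2 * card {y \<in> B. d * y \<in> B})"
      using manyH by (intro sum_mono) (simp add: Suc_leI)
    also have "\<dots> = 2 * (\<Sum>d\<in>H. card {y \<in> B. d * y \<in> B})" by (simp add: sum_distrib_left)
    also have "(\<Sum>d\<in>H. card {y \<in> B. d * y \<in> B}) = card (SIGMA d:H. {y \<in> B. d * y \<in> B})"
      using finH fin by (simp add: card_SigmaI)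
    also have "\<dots> \<le> card (B \<times> B)"
    proof (rule card_inj_on_le[of "\<lambda>(d, y). (d * y, y)"])
      show "inj_on (\<lambda>(d, y). (d * y, y)) (SIGMA d:H. {y \<in> B. d * y \<in> B})"
        using nz by (auto simp: inj_on_def)
    qed (use fin in auto)
    also have "card (B \<times> B) = n * n" using card by (simp add: card_cartesian_product)
    finally show ?thesis by simp
  qed
  have cardH: "card H < 2 * n"
  proof (rule ccontr)
    assume "\<not> card H < 2 * n"
    then have "2 * n * (n + 1) \<le> card H * (n + 1)" by (intro mult_right_mono) auto
    also have "\<dots> \<le> 2 * (n * n)" by fact
    finally show False using card by simp
  qed
  obtain a0 b0 where ab0: "a0 \<in> A" "b0 \<in> B" using card by (metis card.empty equals0I not_less_zero)
  then have nz0: "a0 \<noteq> 0" "b0 \<noteq> 0" using nz by auto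
  have BH: "b / b' \<in> H" if "b \<in> B" "b' \<in> B" for b b' using that by (auto simp: H_def)
  have "0 \<notin> H" using nz by (auto simp: H_def)
  \<comment> \<open>The n-element sets A / a0 and h b0 / B both lie in \<open>H\<close>, which has
    fewer than 2n elements, so they meet. Hence the product set contains the whole coset
    \<open>H\<close> a0 b0.\<close>
  have cover: "h * (a0 * b0) \<in> (\<lambda>(a, b). a * b) ` (A \<times> B)" if h: "h \<in> H" for h
  proof -
    let ?X = "(\<lambda>a. a / a0) ` A" and ?Y = "(\<lambda>b. h / (b / b0)) ` B"
    have "h \<noteq> 0" using h \<open>0 \<notin> H\<close> by auto
    have "card ?X = n" using card nz0 by (subst card_image) (auto simp: inj_on_def)
    moreover have "card ?Y = n" using card nz0 \<open>h \<noteq> 0\<close>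
      by (subst card_image) (auto simp: inj_on_def)
    moreover have "card (?X \<union> ?Y) \<le> card H"
      by (rule card_mono[OF finH], use AH BH div h ab0 in blast)
    moreover have "card ?X + card ?Y = card (?X \<union> ?Y) + card (?X \<inter> ?Y)"
      using fin by (intro card_Un_Int) auto
    ultimately have "card (?X \<inter> ?Y) > 0" using cardH by linarith
    then obtain a b where ab: "a \<in> A" "b \<in> B" "a / a0 = h / (b / b0)" by (auto simp: card_gt_0_iff)
    then have "b \<noteq> 0" using nz by auto
    then have "h * (a0 * b0) = a * b" using ab(3) nz0 by (simp add: frac_eq_eq ac_simps)
    then show ?thesis using ab by auto
  qed
  have "card H \<le> card ((\<lambda>(a, b). a * b) ` (A \<times> B))"
  proof (rule card_inj_on_le)
    show "inj_on (\<lambda>h. h * (a0 * b0)) H" using nz0 by (auto simp: inj_on_def)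
  qed (use cover fin in auto)
  moreover have "1 \<in> H" using BH[OF ab0(2,2)] nz0 by simp
  ultimately show ?thesis by (intro that[OF finH \<open>0 \<notin> H\<close> _ div _ AH BH])
qed

text \<open>Multiplication by \<open>h\<close> permutes \<open>H\<close>, so the product of all
  elements, which is nonzero, equals itself times \<open>h ^ card H\<close>.\<close>

lemma finite_mult_subgroup_root_of_unity:
  fixes H :: "'a::field set"
  assumes "finite H" "0 \<notin> H" "\<And>x y. x \<in> H \<Longrightarrow> y \<in> H \<Longrightarrow> x / y \<in> H" "h \<in> H"
  shows "h ^ card H = 1"
proof -
  have h: "h \<noteq> 0" using assms by auto
  have "1 \<in> H" using assms(3)[OF assms(4,4)] h by simp
  have mult: "h * x \<in> H" if "x \<in> H" for x
    using assms(3)[OF assms(4) assms(3)[OF \<open>1 \<in> H\<close> that]] by simp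
  have "times h ` H = H"
    using mult assms(1) h by (intro endo_inj_surj) (auto simp: inj_on_def)
  then have "\<Prod>H = prod (\<lambda>x. x) (times h ` H)" by simp
  also have "\<dots> = (\<Prod>x\<in>H. h * x)" using h by (subst prod.reindex) (auto simp: inj_on_def)
  also have "\<dots> = h ^ card H * \<Prod>H" by (simp add: prod.distrib)
  finally show ?thesis using assms by (simp add: prod_zero_iff)
qed

section \<open>Reduction to points on the quadric\<close>

lemma card_product_set_le:
  fixes \<phi> :: "'p \<Rightarrow> 'a::field"
  assumes "finite R" "\<And>b g. b \<in> B \<Longrightarrow> g \<in> G \<Longrightarrow> \<exists>r\<in>R. \<psi> r = \<phi> b * \<phi> g"
  shows "card ((\<lambda>(a, b). a * b) ` (\<phi> ` B \<times> \<phi> ` G)) \<le> card R"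
proof -
  have "(\<lambda>(a, b). a * b) ` (\<phi> ` B \<times> \<phi> ` G) \<subseteq> \<psi> ` R"
  proof
    fix z assume "z \<in> (\<lambda>(a, b). a * b) ` (\<phi> ` B \<times> \<phi> ` G)"
    then obtain b g where "b \<in> B" "g \<in> G" "z = \<phi> b * \<phi> g" by auto
    then show "z \<in> \<psi> ` R" using assms(2)[of b g] by (metis imageI)
  qed
  then show ?thesis using assms(1) by (meson card_image_le card_mono finite_imageI le_trans)
qed

text \<open>A point of \<open>R\<close> determines its line through \<open>x\<close>, and by general
  position that line holds at most one point of \<open>Y\<close>.\<close>

lemma pencil_card_le:
  assumes "finite R" "x \<notin> R" "x \<notin> Y" "general_position (insert x Y)"
    "\<And>y. y \<in> Y \<Longrightarrow> \<exists>L. is_line L \<and> x \<in> L \<and> y \<in> L \<and> (\<exists>r\<in>R. r \<in> L)"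
  shows "card Y \<le> card R"
proof -
  obtain f where f: "\<And>y. y \<in> Y \<Longrightarrow> \<exists>L. is_line L \<and> x \<in> L \<and> y \<in> L \<and> f y \<in> R \<and> f y \<in> L"
    using assms(5) by metis
  have "inj_on f Y"
  proof (rule inj_onI)
    fix y z assume yz: "y \<in> Y" "z \<in> Y" "f y = f z"
    obtain L where L: "is_line L" "x \<in> L" "y \<in> L" "f y \<in> R" "f y \<in> L" using f yz by blast
    obtain L' where L': "is_line L'" "x \<in> L'" "z \<in> L'" "f z \<in> R" "f z \<in> L'" using f yz by blast
    have "x \<noteq> f y" using L assms by auto
    then have "L = L'" using line_through_unique[OF L(1) L'(1)] L L' yz(3) by metis
    then show "y = z" using general_positionD[OF assms(4) L(1), of x y z] yz L L' assms(3) by auto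
  qed
  then show ?thesis using f assms(1) by (meson card_inj_on_le image_subsetI)
qed

lemma pierced_configuration_swap:
  "pierced_configuration n B G R Q l \<Longrightarrow> pierced_configuration n G B R Q l"
  unfolding pierced_configuration_def by (simp only: Un_commute[of G B] Int_commute[of G B]) blast

lemma pierced_configurationD:
  assumes "pierced_configuration n B G R Q l"
  shows "B \<inter> G = {}" "B \<inter> R = {}" "G \<inter> R = {}" "general_position (B \<union> G)"
    "card B = n" "card G = n" "n > 6" "finite B" "finite G" "finite R"
    "general_position Q" "is_line l" "B \<subseteq> Q \<union> l" "G \<subseteq> Q \<union> l" "R \<subseteq> Q \<union> l"
    "\<And>b g L. b \<in> B \<Longrightarrow> g \<in> G \<Longrightarrow> is_line L \<Longrightarrow> b \<in> L \<Longrightarrow> g \<in> L \<Longrightarrow> \<exists>r\<in>R. r \<in> L"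
proof -
  note defs = assms[unfolded pierced_configuration_def]
  show "B \<inter> G = {}" "B \<inter> R = {}" "G \<inter> R = {}" "general_position (B \<union> G)"
    "card B = n" "card G = n" "n > 6" "finite R" "is_line l"
    using defs by - (elim conjE, assumption)+
  then show "finite B" "finite G" by (auto intro: card_ge_0_finite)
  show "general_position Q" using defs general_position_quadric by (elim conjE)
  show "B \<subseteq> Q \<union> l" "G \<subseteq> Q \<union> l" "R \<subseteq> Q \<union> l" using defs by - (elim conjE, blast)+
  show "\<exists>r\<in>R. r \<in> L" if "b \<in> B" "g \<in> G" "is_line L" "b \<in> L" "g \<in> L" for b g L
    using defs that by (elim conjE) metis
qed

lemma pierced_configuration_line:
  assumes "pierced_configuration n B G R Q l" "b \<in> B" "g \<in> G"
  shows "\<exists>L r. is_line L \<and> b \<in> L \<and> g \<in> L \<and> r \<in> R \<and> r \<in> L \<and> b \<noteq> g \<and> b \<noteq> r \<and> g \<noteq> r"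
proof -
  note D = pierced_configurationD[OF assms(1)]
  have ne: "b \<noteq> g" using D(1) assms by blast
  then obtain L where L: "is_line L" "b \<in> L" "g \<in> L" using line_through_exists by blast
  then obtain r where "r \<in> R" "r \<in> L" using D(16) assms by blast
  then show ?thesis using L ne D(2,3) assms by blast
qed

lemma card_inter_line_le_1:
  assumes "general_position S" "is_line l" "x \<in> S" "x \<in> l" "Y \<subseteq> S" "x \<notin> Y"
  shows "card (Y \<inter> l) \<le> 1"
proof (cases "finite (Y \<inter> l)")
  case True
  then show ?thesis
    using general_positionD[OF assms(1,2,3)] assms(4-6) by (simp add: card_le_Suc0_iff_eq) blast
qed simp

lemma pierced_configuration_subset_quadric:
  assumes conf: "pierced_configuration n B G R Q l" and small: "2 * card R < 3 * n"
  shows "B \<subseteq> Q"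
proof
  fix x assume x: "x \<in> B"
  show "x \<in> Q"
  proof (rule ccontr)
    assume "x \<notin> Q"
    note D = pierced_configurationD[OF conf]
    have "x \<in> l" using \<open>x \<notin> Q\<close> x D(13) by blast
    have "card (G \<inter> l) \<le> 1"
      using x D(1) \<open>x \<in> l\<close> by (intro card_inter_line_le_1[OF D(4,12), of x]) auto
    moreover have "card (G - l) = card G - card (G \<inter> l)" using D(8,9) by (metis card_Diff_subset_Int finite_Int)
    ultimately have G: "card (G - l) \<ge> n - 1" using D(6) by simp
    have "card ((B - {x}) \<inter> l) \<le> 1"
      using x D(1) \<open>x \<in> l\<close> by (intro card_inter_line_le_1[OF D(4,12), of x]) auto
    moreover have "card ((B - {x}) - l) = card (B - {x}) - card ((B - {x}) \<inter> l)"
      using D(8,9) by (metis card_Diff_subset_Int finite_Int finite_Diff)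
    ultimately have "card ((B - {x}) - l) > 0" using D(5,7,8) x by simp
    then obtain b where b: "b \<in> B" "b \<noteq> x" "b \<notin> l" by (auto simp: card_gt_0_iff)
    \<comment> \<open>The line joining \<open>x\<close> to a point off \<open>l\<close> meets
      \<open>l\<close> only in \<open>x\<close>, which is not in \<open>R\<close>, so its blocking
      point lies off \<open>l\<close>.\<close>
    have "card (G - l) \<le> card (R - l)"
    proof (rule pencil_card_le)
      show "general_position (insert x (G - l))"
        using x by (intro general_position_subset[OF D(4)]) auto
      fix g assume g: "g \<in> G - l"
      obtain L r where L: "is_line L" "x \<in> L" "g \<in> L" "r \<in> R" "r \<in> L" and ne: "x \<noteq> r"
        using pierced_configuration_line[OF conf x, of g] g by blast
      have "r \<notin> l"
      proof
        assume "r \<in> l"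
        then have "L = l" using line_through_unique[OF L(1) D(12) ne] L \<open>x \<in> l\<close> by blast
        then show False using L g by auto
      qed
      then show "\<exists>L. is_line L \<and> x \<in> L \<and> g \<in> L \<and> (\<exists>r\<in>R - l. r \<in> L)" using L by blast
    qed (use D(1,2,10) x in auto)
    \<comment> \<open>Seen from \<open>b\<close>, the joining lines already contain two points of
      \<open>Q\<close>, namely \<open>b\<close> and \<open>g\<close>. Their blocking points are
      therefore off \<open>Q\<close>, hence on \<open>l\<close>.\<close>
    moreover have "card (G - l) \<le> card (R \<inter> l)"
    proof (rule pencil_card_le)
      show "general_position (insert b (G - l))"
        using b by (intro general_position_subset[OF D(4)]) auto
      fix g assume g: "g \<in> G - l"
      obtain L r where L: "is_line L" "b \<in> L" "g \<in> L" "r \<in> R" "r \<in> L"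
        and ne: "b \<noteq> g" "b \<noteq> r" "g \<noteq> r"
        using pierced_configuration_line[OF conf b(1), of g] g by blast
      have "r \<notin> Q"
      proof
        assume "r \<in> Q"
        moreover have "b \<in> Q" "g \<in> Q" using b g D(13,14) by auto
        ultimately show False using general_positionD[OF D(11) L(1)] L ne by blast
      qed
      then show "\<exists>L. is_line L \<and> b \<in> L \<and> g \<in> L \<and> (\<exists>r\<in>R \<inter> l. r \<in> L)" using L D(15) by blast
    qed (use D(1,2,10) b in auto)
    moreover have "card R = card (R \<inter> l) + card (R - l)"
      using D(10) by (metis card_Int_Diff)
    \<comment> \<open>Together the two pencils give 2(n - 1) <= card R, incompatible with 2 card R <
      3n for n > 6.\<close>
    ultimately show False using G small D(7) by linarith
  qed
qed

text \<open>For \<open>b\<close> on both curves and a point \<open>g\<close> of \<open>G\<close> off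
  \<open>l\<close>, the line through them has \<open>b\<close> as its only point on \<open>l\<close>
  and \<open>b\<close>, \<open>g\<close> as its only points on \<open>Q\<close>, so no place is left
  for a blocking point.\<close>

lemma pierced_configuration_off_line:
  assumes conf: "pierced_configuration n B G R Q l" and small: "2 * card R < 3 * n"
  shows "B \<inter> l = {}"
proof (rule ccontr)
  assume "B \<inter> l \<noteq> {}"
  then obtain b where b: "b \<in> B" "b \<in> l" by blast
  note D = pierced_configurationD[OF conf]
  have "card (G \<inter> l) \<le> 1"
    using b D(1) by (intro card_inter_line_le_1[OF D(4,12), of b]) auto
  moreover have "card (G - l) = card G - card (G \<inter> l)" using D(9) by (metis card_Diff_subset_Int finite_Int)
  ultimately have "card (G - l) > 0" using D(6,7) by simp
  then obtain g where g: "g \<in> G" "g \<notin> l" by (auto simp: card_gt_0_iff)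
  obtain L r where L: "is_line L" "b \<in> L" "g \<in> L" "r \<in> R" "r \<in> L"
    and ne: "b \<noteq> g" "b \<noteq> r" "g \<noteq> r"
    using pierced_configuration_line[OF conf b(1) g(1)] by blast
  have "r \<notin> l" using line_through_unique[OF L(1) D(12) ne(2)] L b g by blast
  then have "r \<in> Q" using L D(15) by blast
  moreover have "b \<in> Q" "g \<in> Q"
    using pierced_configuration_subset_quadric[OF conf small] b g
      pierced_configuration_subset_quadric[OF pierced_configuration_swap[OF conf] small] by auto
  ultimately show False using general_positionD[OF D(11) L(1)] L ne by blast
qed

lemma pierced_configuration_pierce:
  assumes conf: "pierced_configuration n B G R Q l" and small: "2 * card R < 3 * n"
    and bg: "b \<in> B" "g \<in> G"
  shows "\<exists>L. is_line L \<and> b \<in> L \<and> g \<in> L \<and> (\<exists>r\<in>R \<inter> l. r \<in> L)"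
proof -
  note D = pierced_configurationD[OF conf]
  obtain L r where L: "is_line L" "b \<in> L" "g \<in> L" "r \<in> R" "r \<in> L"
    and ne: "b \<noteq> g" "b \<noteq> r" "g \<noteq> r"
    using pierced_configuration_line[OF conf bg] by blast
  have "b \<in> Q" "g \<in> Q"
    using pierced_configuration_subset_quadric[OF conf small] bg
      pierced_configuration_subset_quadric[OF pierced_configuration_swap[OF conf] small] by auto
  then have "r \<notin> Q" using general_positionD[OF D(11) L(1)] L ne by blast
  then show ?thesis using L D(15) by blast
qed

section \<open>The chord group\<close>

text \<open>Both p - q and u are orthogonal to (w1, w2), which is nonzero because a line through an
  affine point is not the line at infinity; in the plane this makes them parallel.\<close>

lemma chord_direction:
  assumes "is_line L" "aff p \<in> L" "aff q \<in> L" "p \<noteq> q" "u \<noteq> 0" "at_inf u \<in> L"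
  shows "u$1 * (p$2 - q$2) = u$2 * (p$1 - q$1)"
proof -
  obtain w where w: "w \<noteq> 0" "L = locus (\<lambda>v. w \<bullet> v = 0)" using assms is_line_iff by blast
  have eq: "w$1 * p$1 + w$2 * p$2 + w$3 = 0" "w$1 * q$1 + w$2 * q$2 + w$3 = 0"
    "w$1 * u$1 + w$2 * u$2 = 0"
    using assms w by (simp_all add: aff_mem_line at_inf_mem_line)
  have d: "w$1 * (p$1 - q$1) + w$2 * (p$2 - q$2) = 0" using eq by (simp add: algebra_simps)
  have "w$1 \<noteq> 0 \<or> w$2 \<noteq> 0" using w(1) eq by (auto simp: vec3_eq_iff)
  moreover have "w$1 * (u$1 * (p$2 - q$2) - u$2 * (p$1 - q$1)) =
      (w$1 * u$1 + w$2 * u$2) * (p$2 - q$2) - u$2 * (w$1 * (p$1 - q$1) + w$2 * (p$2 - q$2))"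
    "w$2 * (u$1 * (p$2 - q$2) - u$2 * (p$1 - q$1)) =
      u$1 * (w$1 * (p$1 - q$1) + w$2 * (p$2 - q$2)) - (w$1 * u$1 + w$2 * u$2) * (p$1 - q$1)"
    by (simp_all add: algebra_simps)
  ultimately show ?thesis using d eq(3) by auto
qed

lemma off_line_at_infinity:
  assumes "x \<notin> line_at_infinity" shows "aff (inv aff x) = x"
proof -
  have "x \<in> range aff"
    using assms by (cases x rule: pplane_affine_cases) (auto simp: line_at_infinity_def)
  then show ?thesis by (rule f_inv_into_f)
qed

text \<open>The hypothesis on \<open>\<psi>\<close> says that the direction of a chord determines the product of the
  values of \<open>\<phi>\<close> at its end points, so \<open>card R\<close> bounds a product set.\<close>

lemma pierced_configuration_subgroup:
  fixes \<phi> \<psi> :: "real^2 \<Rightarrow> 'a::field"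
  assumes conf: "pierced_configuration n B G R Q l" and small: "2 * card R < 3 * n"
    and S: "projective_transformation S" "S ` l = line_at_infinity"
    and \<phi>: "\<And>p. aff p \<in> S ` Q \<Longrightarrow> \<phi> p \<noteq> 0" "inj_on \<phi> {p. aff p \<in> S ` Q}"
    and \<psi>: "\<And>p q u. \<lbrakk>aff p \<in> S ` Q; aff q \<in> S ` Q; p \<noteq> q; u \<noteq> 0;
      u$1 * (p$2 - q$2) = u$2 * (p$1 - q$1)\<rbrakk> \<Longrightarrow> \<psi> u = \<phi> p * \<phi> q"
  obtains H where "finite H" "0 \<notin> H" "1 \<in> H" "\<And>x y. x \<in> H \<Longrightarrow> y \<in> H \<Longrightarrow> x / y \<in> H"
    "n \<le> card H" "card H \<le> card R"
    "\<And>x x'. x \<in> B \<Longrightarrow> x' \<in> B \<Longrightarrow> \<phi> (inv aff (S x)) / \<phi> (inv aff (S x')) \<in> H"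
    "\<And>x x'. x \<in> G \<Longrightarrow> x' \<in> G \<Longrightarrow> \<phi> (inv aff (S x)) / \<phi> (inv aff (S x')) \<in> H"
proof -
  note D = pierced_configurationD[OF conf]
  note swap = pierced_configuration_swap[OF conf]
  have inj: "inj S" using S projective_inj by blast
  have "B \<inter> l = {}" "G \<inter> l = {}" "B \<subseteq> Q" "G \<subseteq> Q"
    using pierced_configuration_off_line[OF conf small] pierced_configuration_off_line[OF swap small]
      pierced_configuration_subset_quadric[OF conf small]
      pierced_configuration_subset_quadric[OF swap small] by auto
  then have off: "S x \<notin> line_at_infinity" "S x \<in> S ` Q" if "x \<in> B \<union> G" for x
    using inj that unfolding S(2)[symmetric] by (auto simp: inj_image_mem_iff)
  define p where "p x = inv aff (S x)" for x
  have p: "aff (p x) = S x" "aff (p x) \<in> S ` Q" if "x \<in> B \<union> G" for x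
    using off[OF that] off_line_at_infinity by (simp_all add: p_def)
  have p_inj: "inj_on p (B \<union> G)" using p(1) inj by (metis inj_onI injD)
  \<comment> \<open>A direction fixes \<open>u\<close> only up to a scalar. Any choice works, since
    the hypothesis on \<psi> covers every nonzero vector parallel to the chord.\<close>
  define d where "d r = (SOME u. u \<noteq> 0 \<and> S r = at_inf u)" for r
  have dir: "\<exists>r\<in>R. \<psi> (d r) = \<phi> (p b) * \<phi> (p g)" if bg: "b \<in> B" "g \<in> G" for b g
  proof -
    obtain L r where L: "is_line L" "b \<in> L" "g \<in> L" "r \<in> R" "r \<in> l" "r \<in> L"
      using pierced_configuration_pierce[OF conf small bg] by blast
    have "S r \<in> line_at_infinity" using S L by blast
    then have "\<exists>u. u \<noteq> 0 \<and> S r = at_inf u" by (auto simp: line_at_infinity_def)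
    then have d: "d r \<noteq> 0" "S r = at_inf (d r)" unfolding d_def by (metis (mono_tags, lifting) someI_ex)+
    have "b \<noteq> g" using bg D(1) by auto
    then have ne: "p b \<noteq> p g" using p_inj bg by (auto simp: inj_on_def)
    have "d r$1 * (p b$2 - p g$2) = d r$2 * (p b$1 - p g$1)"
    proof (rule chord_direction[OF projective_is_line[OF S(1) L(1)] _ _ ne d(1)])
      show "aff (p b) \<in> S ` L" "aff (p g) \<in> S ` L" "at_inf (d r) \<in> S ` L"
        using p(1) bg L by (auto simp flip: d(2))
    qed
    then have "\<psi> (d r) = \<phi> (p b) * \<phi> (p g)"
      using bg ne d(1) p(2) by (intro \<psi>) auto
    then show ?thesis using L by blast
  qed
  define f where "f x = \<phi> (p x)" for x
  have "inj_on \<phi> (p ` (B \<union> G))" using p(2) by (intro inj_on_subset[OF \<phi>(2)]) auto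
  then have f_inj: "inj_on f (B \<union> G)" using p_inj by (auto simp: f_def inj_on_def)
  then have cards: "card (f ` B) = n" "card (f ` G) = n"
    using D by (auto simp: card_image inj_on_subset)
  have nz: "0 \<notin> f ` B" "0 \<notin> f ` G" using \<phi>(1) p(2) by (auto simp: f_def)
  have le: "card ((\<lambda>(a, b). a * b) ` (f ` B \<times> f ` G)) \<le> card R"
    by (rule card_product_set_le[where \<psi> = "\<lambda>r. \<psi> (d r)", OF D(10)]) (use dir in \<open>auto simp: f_def\<close>)
  then have lt: "2 * card ((\<lambda>(a, b). a * b) ` (f ` B \<times> f ` G)) < 3 * n" using small by linarith
  obtain H where H: "finite H" "0 \<notin> H" "1 \<in> H" "\<And>x y. x \<in> H \<Longrightarrow> y \<in> H \<Longrightarrow> x / y \<in> H"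
    "card H \<le> card ((\<lambda>(a, b). a * b) ` (f ` B \<times> f ` G))"
    "\<And>a a'. a \<in> f ` B \<Longrightarrow> a' \<in> f ` B \<Longrightarrow> a / a' \<in> H"
    "\<And>b b'. b \<in> f ` G \<Longrightarrow> b' \<in> f ` G \<Longrightarrow> b / b' \<in> H"
    by (rule small_product_set[OF _ _ cards _ nz lt]) (use D in auto)
  have "n \<le> card H"
  proof -
    have "f ` B \<noteq> {}" using cards D(7) by auto
    then obtain a where a: "a \<in> f ` B" by blast
    then have "a \<noteq> 0" using nz by auto
    have "card (f ` B) \<le> card H"
      by (rule card_inj_on_le[of "\<lambda>x. x / a"]) (use H a \<open>a \<noteq> 0\<close> in \<open>auto simp: inj_on_def\<close>)
    then show ?thesis using cards by simp
  qed
  show ?thesis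
    by (rule that[OF H(1-4) \<open>n \<le> card H\<close> order.trans[OF H(5) le]]) (use H(6,7) in \<open>auto simp: f_def p_def\<close>)
qed

section \<open>The groups of the parabola, the hyperbola and the circle\<close>

lemma no_large_real_subgroup:
  fixes H :: "real set"
  assumes "finite H" "0 \<notin> H" "\<And>x y. x \<in> H \<Longrightarrow> y \<in> H \<Longrightarrow> x / y \<in> H" "1 \<in> H"
  shows "card H \<le> 2"
proof -
  have "card H > 0" using assms by (auto simp: card_gt_0_iff)
  have "H \<subseteq> {1, -1}"
  proof
    fix h assume "h \<in> H"
    then have "h ^ card H = 1" using finite_mult_subgroup_root_of_unity assms by metis
    then have "\<bar>h\<bar> = 1" using power_eq_1_iff[of h "card H"] \<open>card H > 0\<close> by auto
    then show "h \<in> {1, -1}" by auto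
  qed
  then have "card H \<le> card {1, -1 :: real}" by (intro card_mono) auto
  then show ?thesis by simp
qed

lemma aff_in_unit_circle: "aff p \<in> unit_circle \<longleftrightarrow> (p$1)\<^sup>2 + (p$2)\<^sup>2 = 1"
  unfolding unit_circle_def
  by (subst aff_mem_locus) (auto simp: power_mult_distrib simp flip: distrib_left)

lemma not_std_parabola:
  assumes conf: "pierced_configuration n B G R Q l" and small: "2 * card R < 3 * n"
    and S: "projective_transformation S" "S ` l = line_at_infinity"
  shows "S ` Q \<noteq> std_parabola"
proof
  assume Q: "S ` Q = std_parabola"
  have mem: "aff p \<in> S ` Q \<longleftrightarrow> (p$1)\<^sup>2 = p$2" for p
    unfolding Q std_parabola_def by (subst aff_mem_locus) (auto simp: power2_eq_square)
  obtain H :: "real set" where "finite H" "0 \<notin> H" "1 \<in> H" "\<And>x y. x \<in> H \<Longrightarrow> y \<in> H \<Longrightarrow> x / y \<in> H"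
    "n \<le> card H"
  \<comment> \<open>The chord between abscissas x and y of the parabola has slope x + y; the
    exponential turns this sum into a product.\<close>
  proof (rule pierced_configuration_subgroup[OF conf small S, where \<phi> = "\<lambda>p. exp (p$1)"
        and \<psi> = "\<lambda>u. exp (u$2 / u$1)"])
    show "inj_on (\<lambda>p. exp (p$1)) {p. aff p \<in> S ` Q}"
      unfolding mem by (auto simp: inj_on_def vec2_eq_iff)
    fix p q u :: "real^2"
    assume pq: "aff p \<in> S ` Q" "aff q \<in> S ` Q" "p \<noteq> q" "u \<noteq> 0" "u$1 * (p$2 - q$2) = u$2 * (p$1 - q$1)"
    then have ne: "p$1 \<noteq> q$1" and eq: "p$2 = (p$1)\<^sup>2" "q$2 = (q$1)\<^sup>2"
      unfolding mem by (auto simp: vec2_eq_iff)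
    have "(u$1 * (p$1 + q$1)) * (p$1 - q$1) = u$2 * (p$1 - q$1)"
      using pq(5) unfolding eq by (simp add: algebra_simps power2_eq_square)
    then have "u$2 = u$1 * (p$1 + q$1)" using ne by simp
    moreover from this have "u$1 \<noteq> 0" using pq(4) by (auto simp: vec2_eq_iff)
    ultimately show "exp (u$2 / u$1) = exp (p$1) * exp (q$1)" by (simp add: exp_add)
  qed auto
  then show False using no_large_real_subgroup[of H] pierced_configurationD(7)[OF conf] by simp
qed

lemma not_std_hyperbola:
  assumes conf: "pierced_configuration n B G R Q l" and small: "2 * card R < 3 * n"
    and S: "projective_transformation S" "S ` l = line_at_infinity"
  shows "S ` Q \<noteq> std_hyperbola"
proof
  assume Q: "S ` Q = std_hyperbola"
  have mem: "aff p \<in> S ` Q \<longleftrightarrow> p$1 * p$2 = 1" for p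
    unfolding Q std_hyperbola_def by (subst aff_mem_locus) (auto simp: power2_eq_square)
  obtain H :: "real set" where "finite H" "0 \<notin> H" "1 \<in> H" "\<And>x y. x \<in> H \<Longrightarrow> y \<in> H \<Longrightarrow> x / y \<in> H"
    "n \<le> card H"
  \<comment> \<open>The chord between abscissas x and y of the hyperbola has slope -1/(x y).\<close>
  proof (rule pierced_configuration_subgroup[OF conf small S, where \<phi> = "\<lambda>p. p$1"
        and \<psi> = "\<lambda>u. - u$1 / u$2"])
    show "p$1 \<noteq> 0" if "aff p \<in> S ` Q" for p using that unfolding mem by auto
    show "inj_on (\<lambda>p. p$1) {p. aff p \<in> S ` Q}"
      unfolding mem by (auto simp: inj_on_def vec2_eq_iff) (metis mult_cancel_left mult_zero_left zero_neq_one)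
    fix p q u :: "real^2"
    assume pq: "aff p \<in> S ` Q" "aff q \<in> S ` Q" "p \<noteq> q" "u \<noteq> 0" "u$1 * (p$2 - q$2) = u$2 * (p$1 - q$1)"
    then have nz: "p$1 \<noteq> 0" "q$1 \<noteq> 0" unfolding mem by auto
    then have eq: "p$2 = 1 / p$1" "q$2 = 1 / q$1"
      using pq(1,2) unfolding mem by (simp_all add: nonzero_eq_divide_eq mult.commute)
    have ne: "p$1 \<noteq> q$1" using pq(3) eq by (auto simp: vec2_eq_iff)
    have "u$1 * (p$1 - q$1) = - (p$1 * q$1) * (u$1 * (p$2 - q$2))" using nz by (simp add: eq field_simps)
    also have "\<dots> = - u$2 * (p$1 * q$1) * (p$1 - q$1)" unfolding pq(5) by simp
    finally have "u$1 * (p$1 - q$1) = - u$2 * (p$1 * q$1) * (p$1 - q$1)" .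
    then have u: "u$1 = - u$2 * (p$1 * q$1)" using ne by (metis mult_right_cancel right_minus_eq)
    then have "u$2 \<noteq> 0" using pq(4) by (auto simp: vec2_eq_iff)
    then show "- u$1 / u$2 = p$1 * q$1" using u by simp
  qed auto
  then show False using no_large_real_subgroup[of H] pierced_configurationD(7)[OF conf] by simp
qed

lemma unit_circle_subgroup:
  assumes conf: "pierced_configuration n B G R Q l" and small: "2 * card R < 3 * n"
    and S: "projective_transformation S" "S ` l = line_at_infinity" "S ` Q = unit_circle"
  obtains H :: "complex set" where "finite H" "0 \<notin> H" "1 \<in> H" "\<And>x y. x \<in> H \<Longrightarrow> y \<in> H \<Longrightarrow> x / y \<in> H"
    "n \<le> card H" "card H \<le> card R"
    "\<And>x x' p p'. x \<in> B \<Longrightarrow> x' \<in> B \<Longrightarrow> S x = aff p \<Longrightarrow> S x' = aff p' \<Longrightarrow>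
      Complex (p$1) (p$2) / Complex (p'$1) (p'$2) \<in> H"
    "\<And>x x' p p'. x \<in> G \<Longrightarrow> x' \<in> G \<Longrightarrow> S x = aff p \<Longrightarrow> S x' = aff p' \<Longrightarrow>
      Complex (p$1) (p$2) / Complex (p'$1) (p'$2) \<in> H"
proof -
  have inv: "inv aff (aff p) = p" for p by (rule inv_f_f) (auto simp: inj_on_def aff_eq_iff)
  have mem: "aff p \<in> S ` Q \<longleftrightarrow> (p$1)\<^sup>2 + (p$2)\<^sup>2 = 1" for p unfolding S(3) by (rule aff_in_unit_circle)
  show ?thesis
  \<comment> \<open>For unit numbers, y z cnj(y - z) = -(y - z). A direction w is a real multiple of
    y - z, so w / cnj w = (y - z) / cnj(y - z) and y z = -w / cnj w.\<close>
  proof (rule pierced_configuration_subgroup[OF conf small S(1,2), where \<phi> = "\<lambda>p. Complex (p$1) (p$2)"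
        and \<psi> = "\<lambda>u. - Complex (u$1) (u$2) / cnj (Complex (u$1) (u$2))"])
    show "Complex (p$1) (p$2) \<noteq> 0" if "aff p \<in> S ` Q" for p
      using that unfolding mem by (auto simp: complex_eq_iff)
    show "inj_on (\<lambda>p. Complex (p$1) (p$2)) {p. aff p \<in> S ` Q}"
      by (auto simp: inj_on_def vec2_eq_iff)
    fix p q u :: "real^2"
    assume pq: "aff p \<in> S ` Q" "aff q \<in> S ` Q" "p \<noteq> q" "u \<noteq> 0" "u$1 * (p$2 - q$2) = u$2 * (p$1 - q$1)"
    define y z w where "y = Complex (p$1) (p$2)" and "z = Complex (q$1) (q$2)" and "w = Complex (u$1) (u$2)"
    have "y \<noteq> z" "w \<noteq> 0" using pq by (auto simp: y_def z_def w_def vec2_eq_iff complex_eq_iff)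
    have unit: "y * cnj y = 1" "z * cnj z = 1"
      using pq(1,2) unfolding mem by (simp_all add: y_def z_def complex_eq_iff power2_eq_square)
    have "w * cnj (y - z) = cnj w * (y - z)"
      using pq(5) by (simp add: w_def y_def z_def complex_eq_iff algebra_simps)
    moreover have "y * z * cnj (y - z) = - (y - z)"
    proof -
      have "y * z * cnj (y - z) = (y * cnj y) * z - (z * cnj z) * y" by (simp add: algebra_simps)
      then show ?thesis by (simp add: unit)
    qed
    ultimately have "cnj w * (y * z) * cnj (y - z) = - w * cnj (y - z)"
      by (metis (no_types, lifting) mult.assoc mult_minus_left mult_minus_right)
    then have "cnj w * (y * z) = - w" using \<open>y \<noteq> z\<close> by (metis complex_cnj_cancel_iff complex_cnj_zero mult_right_cancel right_minus_eq)
    then have "y * z = - w / cnj w" using \<open>w \<noteq> 0\<close> by (simp add: field_simps)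
    then show "- Complex (u$1) (u$2) / cnj (Complex (u$1) (u$2)) = Complex (p$1) (p$2) * Complex (q$1) (q$2)"
      by (simp add: w_def y_def z_def)
  next
    fix H :: "complex set"
    assume H: "finite H" "0 \<notin> H" "1 \<in> H" "\<And>x y. x \<in> H \<Longrightarrow> y \<in> H \<Longrightarrow> x / y \<in> H"
      "n \<le> card H" "card H \<le> card R"
      and B: "\<And>x x'. x \<in> B \<Longrightarrow> x' \<in> B \<Longrightarrow> Complex (inv aff (S x)$1) (inv aff (S x)$2) /
        Complex (inv aff (S x')$1) (inv aff (S x')$2) \<in> H"
      and G: "\<And>x x'. x \<in> G \<Longrightarrow> x' \<in> G \<Longrightarrow> Complex (inv aff (S x)$1) (inv aff (S x)$2) /
        Complex (inv aff (S x')$1) (inv aff (S x')$2) \<in> H"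
    show thesis
    proof (rule that[OF H])
      show "Complex (p$1) (p$2) / Complex (p'$1) (p'$2) \<in> H"
        if "x \<in> B" "x' \<in> B" "S x = aff p" "S x' = aff p'" for x x' p p'
        using B[OF that(1,2)] by (simp add: that inv)
      show "Complex (p$1) (p$2) / Complex (p'$1) (p'$2) \<in> H"
        if "x \<in> G" "x' \<in> G" "S x = aff p" "S x' = aff p'" for x x' p p'
        using G[OF that(1,2)] by (simp add: that inv)
    qed
  qed
qed

text \<open>Dividing by one fixed point of \<open>X\<close> lands in \<open>H\<close>, hence among
  the roots of unity of order dividing \<open>card H\<close>. The argument \<open>t\<close> of that
  point is the rotation of the polygon.\<close>

lemma within_polygon:
  fixes H :: "complex set"
  assumes H: "finite H" "0 \<notin> H" "\<And>x y. x \<in> H \<Longrightarrow> y \<in> H \<Longrightarrow> x / y \<in> H" "card H \<ge> 3"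
    and X: "\<And>x. x \<in> X \<Longrightarrow> x \<in> unit_circle"
      "\<And>p p'. aff p \<in> X \<Longrightarrow> aff p' \<in> X \<Longrightarrow> Complex (p$1) (p$2) / Complex (p'$1) (p'$2) \<in> H"
    and "X \<noteq> {}"
  shows "within_inscribed_regular_polygon (card H) unit_circle X"
proof -
  let ?m = "card H"
  have form: "\<exists>p. x = aff p \<and> cmod (Complex (p$1) (p$2)) = 1" if x: "x \<in> unit_circle" for x
  proof -
    obtain p where "x = aff p" using x unfolding unit_circle_eq by blast
    then show ?thesis using x by (auto simp: aff_in_unit_circle cmod_def)
  qed
  obtain p0 where p0: "aff p0 \<in> X" "cmod (Complex (p0$1) (p0$2)) = 1" using form X(1) \<open>X \<noteq> {}\<close> by blast
  define t where "t = Arg (Complex (p0$1) (p0$2))"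
  have t: "Complex (p0$1) (p0$2) = cis t"
    using rcis_cmod_Arg[of "Complex (p0$1) (p0$2)"] p0(2) by (simp add: rcis_def t_def)
  define V where "V = (\<lambda>k. aff (0 + 1 *\<^sub>R vector [cos (t + 2 * pi * real k / real ?m),
                                       sin (t + 2 * pi * real k / real ?m)])) ` {..<?m}"
  have "regular_polygon_vertices ?m V" unfolding regular_polygon_vertices_def V_def
    using H(4) by (intro conjI exI[of _ 0] exI[of _ 1] exI[of _ t]) auto
  moreover have "V \<subseteq> unit_circle" by (auto simp: V_def aff_in_unit_circle)
  moreover have "X \<subseteq> V"
  proof
    fix x assume x: "x \<in> X"
    obtain p where p: "x = aff p" "cmod (Complex (p$1) (p$2)) = 1" using form X(1) x by blast
    have h: "Complex (p$1) (p$2) / cis t \<in> H" using X(2)[of p p0] x p p0 t by simp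
    then have "(Complex (p$1) (p$2) / cis t) ^ ?m = 1"
      using finite_mult_subgroup_root_of_unity[OF H(1-3)] by blast
    then obtain k where k: "k < ?m" "Complex (p$1) (p$2) / cis t = cis (2 * pi * real k / real ?m)"
      using bij_betw_imp_surj_on[OF Complex.bij_betw_roots_unity[of ?m]] H(4) by force
    have "Complex (p$1) (p$2) = cis t * (Complex (p$1) (p$2) / cis t)" by simp
    also have "\<dots> = cis (t + 2 * pi * real k / real ?m)" unfolding k(2) by (rule cis_mult)
    finally have "Complex (p$1) (p$2) = cis (t + 2 * pi * real k / real ?m)" .
    then have "p = 0 + 1 *\<^sub>R vector [cos (t + 2 * pi * real k / real ?m), sin (t + 2 * pi * real k / real ?m)]"
      by (simp add: vec2_eq_iff complex_eq_iff)
    then show "x \<in> V" unfolding V_def p(1) using k(1) by (intro image_eqI[of _ _ k]) auto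
  qed
  ultimately show ?thesis unfolding within_inscribed_regular_polygon_def by blast
qed

section \<open>The ellipse and the inscribed polygons\<close>

lemma affine_transformation_id: "affine_transformation id"
  unfolding affine_transformation_def
  by (intro exI[of _ "mat 1"] exI[of _ 0]) (auto simp: invertible_def)

lemma is_circle_unit_circle: "is_circle unit_circle"
  unfolding is_circle_def unit_circle_eq by (intro exI[of _ 0] exI[of _ 1]) simp

lemma pierced_configuration_normal_form:
  assumes conf: "pierced_configuration n B G R Q l" and small: "2 * card R < 3 * n"
  obtains S where "projective_transformation S" "S ` l = line_at_infinity" "S ` Q = unit_circle"
proof -
  have "is_quadric Q" "is_line l" using conf by (auto simp: pierced_configuration_def)
  then show ?thesis
    using that not_std_parabola[OF conf small] not_std_hyperbola[OF conf small]
    by (metis quadric_line_normal_form)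
qed

text \<open>Two projective maps that send \<open>l\<close> to infinity differ by one that preserves
  the line at infinity, that is, by an affinity. So \<open>T\<close> inherits the conclusion from
  the normalizing map \<open>S\<close>.\<close>

lemma pierced_configuration_ellipse:
  assumes conf: "pierced_configuration n B G R Q l" and small: "2 * card R < 3 * n"
    and T: "projective_transformation T" "T ` l = line_at_infinity"
  shows "is_ellipse (T ` Q)"
proof -
  obtain S where S: "projective_transformation S" "S ` l = line_at_infinity" "S ` Q = unit_circle"
    using pierced_configuration_normal_form[OF conf small] by blast
  obtain S' where S': "projective_transformation S'" "S' \<circ> S = id"
    using projective_inverse[OF S(1)] by blast
  have pull: "(T \<circ> S') ` S ` X = T ` X" for X
  proof -
    have "(T \<circ> S') ` S ` X = T ` (S' \<circ> S) ` X" by (simp only: image_comp comp_assoc)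
    then show ?thesis by (simp add: S'(2))
  qed
  have "affine_transformation (T \<circ> S')"
    using projective_comp[OF T(1) S'(1)] pull[of l] S(2) T(2) by (intro projective_imp_affine) auto
  then show ?thesis using pull[of Q] S(3) is_circle_unit_circle unfolding is_ellipse_def by metis
qed

text \<open>With \<open>l\<close> already at infinity, the normalizing map is itself an affinity,
  and the order of the subgroup serves as \<open>m\<close> for both colours.\<close>

lemma pierced_configuration_polygonal:
  assumes conf: "pierced_configuration n B G R Q line_at_infinity" and small: "2 * card R < 3 * n"
  shows "polygonal_up_to_affinity Q B G R"
proof -
  note D = pierced_configurationD[OF conf]
  obtain S where S: "projective_transformation S" "S ` line_at_infinity = line_at_infinity"
      "S ` Q = unit_circle"
    using pierced_configuration_normal_form[OF conf small] by blast
  obtain H :: "complex set" where H: "finite H" "0 \<notin> H" "1 \<in> H"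
    "\<And>x y. x \<in> H \<Longrightarrow> y \<in> H \<Longrightarrow> x / y \<in> H" "n \<le> card H" "card H \<le> card R"
    "\<And>x x' p p'. x \<in> B \<Longrightarrow> x' \<in> B \<Longrightarrow> S x = aff p \<Longrightarrow> S x' = aff p' \<Longrightarrow>
      Complex (p$1) (p$2) / Complex (p'$1) (p'$2) \<in> H"
    "\<And>x x' p p'. x \<in> G \<Longrightarrow> x' \<in> G \<Longrightarrow> S x = aff p \<Longrightarrow> S x' = aff p' \<Longrightarrow>
      Complex (p$1) (p$2) / Complex (p'$1) (p'$2) \<in> H"
    by (rule unit_circle_subgroup[OF conf small S]) blast
  have sub: "B \<subseteq> Q" "G \<subseteq> Q"
    using pierced_configuration_subset_quadric[OF conf small]
      pierced_configuration_subset_quadric[OF pierced_configuration_swap[OF conf] small] by auto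
  have "card H \<ge> 3" using H(5) D(7) by simp
  have "within_inscribed_regular_polygon (card H) unit_circle (S ` B)"
  proof (rule within_polygon[OF H(1,2,4) \<open>card H \<ge> 3\<close>])
    show "S ` B \<noteq> {}" using D by auto
    show "x \<in> unit_circle" if "x \<in> S ` B" for x using that sub S(3) by blast
    show "Complex (p$1) (p$2) / Complex (p'$1) (p'$2) \<in> H" if "aff p \<in> S ` B" "aff p' \<in> S ` B" for p p'
      using that H(7) by (metis imageE)
  qed
  moreover have "within_inscribed_regular_polygon (card H) unit_circle (S ` G)"
  proof (rule within_polygon[OF H(1,2,4) \<open>card H \<ge> 3\<close>])
    show "S ` G \<noteq> {}" using D by auto
    show "x \<in> unit_circle" if "x \<in> S ` G" for x using that sub S(3) by blast
    show "Complex (p$1) (p$2) / Complex (p'$1) (p'$2) \<in> H" if "aff p \<in> S ` G" "aff p' \<in> S ` G" for p p'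
      using that H(8) by (metis imageE)
  qed
  ultimately show ?thesis unfolding polygonal_up_to_affinity_def
    using projective_imp_affine[OF S(1,2)] S(3) is_circle_unit_circle H(6)
    by (intro exI[of _ S] exI[of _ "card H"]) simp
qed

section \<open>Rigidity of inscribed polygons\<close>

lemma unit_circle_affine_rigid:
  assumes "invertible A" "r > 0" "\<And>v. norm v = 1 \<Longrightarrow> A *v v + b \<in> sphere c r"
  shows "norm (A *v v) = r * norm (v :: real^2)"
proof -
  define d where "d = b - c"
  have eq: "(A *v v) \<bullet> (A *v v) + 2 * ((A *v v) \<bullet> d) + d \<bullet> d = r\<^sup>2" if "norm v = 1" for v
  proof -
    have "norm (A *v v + d) = r" using assms(3)[OF that]
      by (simp add: d_def dist_norm norm_minus_commute algebra_simps)
    then have "(A *v v + d) \<bullet> (A *v v + d) = r\<^sup>2" by (simp add: dot_square_norm)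
    then show ?thesis by (simp add: inner_add inner_commute)
  qed
  \<comment> \<open>Comparing \<open>v\<close> with \<open>- v\<close>, only the middle term of
    \<open>eq\<close> changes sign, so it vanishes. As \<open>A\<close> is onto, \<open>d\<close> is
    then orthogonal to itself: the centre goes to the centre.\<close>
  have orth: "(A *v v) \<bullet> d = 0" if "norm v = 1" for v
    using eq[OF that] eq[of "- v"] that matrix_vector_mult_scaleR[of A "-1" v] by simp
  have "d = 0"
  proof -
    obtain A' where "A ** A' = mat 1" using assms(1) by (auto simp: invertible_def)
    then have d: "A *v (A' *v d) = d" by (simp add: matrix_vector_mul_assoc)
    show ?thesis
    proof (cases "A' *v d = 0")
      case True then show ?thesis using d by simp
    next
      case False
      then have "(A *v ((1 / norm (A' *v d)) *\<^sub>R (A' *v d))) \<bullet> d = 0" by (intro orth) simp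
      then show ?thesis using False by (simp add: matrix_vector_mult_scaleR d)
    qed
  qed
  then have unit: "norm (A *v v) = r" if "norm v = 1" for v
    using eq[OF that] assms(2) by (simp add: dot_square_norm)
  show ?thesis
  proof (cases "v = 0")
    case False
    then have "norm (A *v ((1 / norm v) *\<^sub>R v)) = r" by (intro unit) simp
    then show ?thesis using False by (simp add: matrix_vector_mult_scaleR field_simps)
  qed simp
qed

text \<open>The polygon brings its own centre and radius. Three consecutive vertices suffice to show
  that the centres agree: the sinusoid \<open>f\<close> takes one value K at \<open>t\<close>, t + x
  and t + 2x, which forces \<open>f\<close> to vanish.\<close>

lemma regular_polygon_in_circle:
  assumes "m \<ge> 3" "r > 0" "r' > 0"
    and V: "\<And>k. k < m \<Longrightarrow> c' + r' *\<^sub>R vector [cos (t + 2 * pi * real k / real m),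
      sin (t + 2 * pi * real k / real m)] \<in> sphere (c :: real^2) r"
  shows "r' = r"
proof -
  define x where "x = 2 * pi / real m"
  define d where "d = c' - c"
  define f where "f \<alpha> = d$1 * cos \<alpha> + d$2 * sin \<alpha>" for \<alpha>
  have x: "0 < x" "x < pi" using assms(1) by (auto simp: x_def field_simps)
  have on: "(norm d)\<^sup>2 + 2 * r' * f (t + real k * x) + r'\<^sup>2 = r\<^sup>2" if "k < m" for k
  proof -
    let ?w = "vector [cos (t + real k * x), sin (t + real k * x)] :: real^2"
    have "c' + r' *\<^sub>R ?w \<in> sphere c r" using V[OF that] by (simp add: x_def mult_ac)
    then have "norm (d + r' *\<^sub>R ?w) = r" by (simp add: d_def dist_norm norm_minus_commute algebra_simps)
    then have "(d + r' *\<^sub>R ?w) \<bullet> (d + r' *\<^sub>R ?w) = r\<^sup>2" by (simp add: dot_square_norm)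
    moreover have "?w \<bullet> ?w = 1" "d \<bullet> ?w = f (t + real k * x)"
      by (simp_all add: inner_vec_def sum_2 f_def flip: power2_eq_square)
    ultimately show ?thesis
      by (simp add: inner_add inner_commute power2_norm_eq_inner) (simp add: power2_eq_square algebra_simps)
  qed
  define K where "K = f t"
  have "2 * r' * f (t + x) = 2 * r' * K" "2 * r' * f (t + 2 * x) = 2 * r' * K"
  proof -
    have "(norm d)\<^sup>2 + 2 * r' * f t + r'\<^sup>2 = r\<^sup>2" "(norm d)\<^sup>2 + 2 * r' * f (t + x) + r'\<^sup>2 = r\<^sup>2"
      "(norm d)\<^sup>2 + 2 * r' * f (t + 2 * x) + r'\<^sup>2 = r\<^sup>2"
      using on[of 0] on[of 1] on[of 2] assms(1) by auto
    then show "2 * r' * f (t + x) = 2 * r' * K" "2 * r' * f (t + 2 * x) = 2 * r' * K"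
      unfolding K_def by linarith+
  qed
  then have K: "f (t + x) = K" "f (t + 2 * x) = K" using assms(3) by simp_all
  \<comment> \<open>The linear recurrence of a sinusoid with step x. With all three values equal to
    K it reads K (1 - cos x) = 0, and cos x < 1.\<close>
  have "f (t + 2 * x) + f t = 2 * cos x * f (t + x)"
  proof -
    have "f ((t + x) + x) + f ((t + x) - x) = 2 * cos x * f (t + x)"
      unfolding f_def cos_add[of "t + x" x] cos_diff[of "t + x" x] sin_add[of "t + x" x] sin_diff[of "t + x" x]
      by (simp add: algebra_simps)
    then show ?thesis by (simp add: algebra_simps)
  qed
  then have "K * (1 - cos x) = 0" using K K_def by (simp add: algebra_simps)
  moreover have "cos x < 1" using cos_monotone_0_pi[of 0 x] x by simp
  ultimately have "K = 0" by simp
  \<comment> \<open>The derivative of \<open>f\<close> at \<open>t\<close>. Value and derivative are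
    the coordinates of \<open>d\<close> in a rotated orthonormal frame, so their squares add up to
    the squared length of \<open>d\<close>.\<close>
  define g where "g = d$2 * cos t - d$1 * sin t"
  have "f (t + x) = f t * cos x + g * sin x"
    unfolding f_def g_def by (simp add: sin_add cos_add algebra_simps)
  then have "g = 0" using K \<open>K = 0\<close> K_def sin_gt_zero[OF x] by simp
  have "(norm d)\<^sup>2 = (d$1)\<^sup>2 + (d$2)\<^sup>2"
    unfolding power2_norm_eq_inner by (simp add: inner_vec_def sum_2 power2_eq_square)
  also have "\<dots> = ((d$1)\<^sup>2 + (d$2)\<^sup>2) * ((sin t)\<^sup>2 + (cos t)\<^sup>2)" by simp
  also have "\<dots> = (f t)\<^sup>2 + g\<^sup>2" unfolding f_def g_def by algebra
  finally have "norm d = 0" using \<open>g = 0\<close> \<open>K = 0\<close> K_def by simp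
  then have "r'\<^sup>2 = r\<^sup>2" using on[of 0] assms(1) \<open>K = 0\<close> K_def by simp
  then show ?thesis using assms(2,3) by (simp add: power2_eq_iff_nonneg)
qed

lemma norm_chord_squared:
  "(norm (vector [cos \<alpha>, sin \<alpha>] - vector [cos \<beta>, sin \<beta>] :: real^2))\<^sup>2 = 2 - 2 * cos (\<alpha> - \<beta>)"
proof -
  have "(norm (vector [cos \<alpha>, sin \<alpha>] - vector [cos \<beta>, sin \<beta>] :: real^2))\<^sup>2 =
      ((cos \<alpha>)\<^sup>2 + (sin \<alpha>)\<^sup>2) + ((cos \<beta>)\<^sup>2 + (sin \<beta>)\<^sup>2) - 2 * cos (\<alpha> - \<beta>)"
    unfolding cos_diff by (simp only: power2_norm_eq_inner inner_vec_def sum_2)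
      (simp add: power2_eq_square algebra_simps)
  then show ?thesis by simp
qed

text \<open>By rigidity, \<open>T\<close> stretches the chord between the two points by
  \<open>r\<close>, and its image joins two vertices of an m-gon of radius \<open>r\<close>. Equal
  chord lengths mean equal cosines of the angle differences, so the original difference is a
  multiple of 2 pi / m.\<close>

lemma inscribed_polygon_chord:
  assumes T: "affine_transformation T" "is_circle (T ` unit_circle)"
    and poly: "within_inscribed_regular_polygon m (T ` unit_circle) (T ` X)"
    and X: "aff (vector [cos \<alpha>, sin \<alpha>]) \<in> X" "aff (vector [cos \<beta>, sin \<beta>]) \<in> X"
  obtains d n :: int where "(\<alpha> - \<beta>) * real m = 2 * pi * real_of_int (d + n * int m)" "m \<ge> 3"
proof -
  obtain A :: "real^2^2" and b where A: "invertible A" "\<And>p. T (aff p) = aff (A *v p + b)"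
    using T(1) by (auto simp: affine_transformation_def)
  obtain c r where c: "r > 0" "T ` unit_circle = aff ` sphere c r" using T(2) by (auto simp: is_circle_def)
  have sph: "p \<in> sphere c r" if "aff p \<in> T ` unit_circle" for p
    using that unfolding c(2) by (auto simp: aff_eq_iff)
  have rigid: "norm (A *v v) = r * norm v" for v
  proof (rule unit_circle_affine_rigid[OF A(1) c(1)])
    fix v :: "real^2" assume "norm v = 1"
    then have "aff v \<in> unit_circle" unfolding unit_circle_eq by simp
    then show "A *v v + b \<in> sphere c r" using A(2)[of v] sph by (metis imageI)
  qed
  obtain V where V: "regular_polygon_vertices m V" "V \<subseteq> T ` unit_circle" "T ` X \<subseteq> V"
    using poly by (auto simp: within_inscribed_regular_polygon_def)
  obtain c' r' t where m: "m \<ge> 3" "r' > 0" and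
    V_eq: "V = (\<lambda>k. aff (c' + r' *\<^sub>R vector [cos (t + 2 * pi * real k / real m),
                                       sin (t + 2 * pi * real k / real m)])) ` {..<m}"
    using V(1) by (auto simp: regular_polygon_vertices_def)
  have "r' = r"
    by (rule regular_polygon_in_circle[OF m(1) c(1) m(2), where c' = c' and t = t and c = c], rule sph)
      (use V(2) in \<open>auto simp: V_eq\<close>)
  let ?w = "\<lambda>\<gamma>. vector [cos \<gamma>, sin \<gamma>] :: real^2"
  let ?\<gamma> = "\<lambda>k. t + 2 * pi * real k / real m"
  have vert: "\<exists>k. A *v ?w \<gamma> + b = c' + r *\<^sub>R ?w (?\<gamma> k)" if "aff (?w \<gamma>) \<in> X" for \<gamma>
  proof -
    have "aff (A *v ?w \<gamma> + b) \<in> V" using that V(3) A(2) by (metis image_subset_iff)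
    then show ?thesis unfolding V_eq by (auto simp: aff_eq_iff \<open>r' = r\<close>)
  qed
  obtain i where i: "A *v ?w \<alpha> + b = c' + r *\<^sub>R ?w (?\<gamma> i)" using vert X by blast
  obtain j where j: "A *v ?w \<beta> + b = c' + r *\<^sub>R ?w (?\<gamma> j)" using vert X by blast
  have "A *v (?w \<alpha> - ?w \<beta>) = (A *v ?w \<alpha> + b) - (A *v ?w \<beta> + b)"
    by (simp add: matrix_vector_mult_diff_distrib)
  also have "\<dots> = r *\<^sub>R (?w (?\<gamma> i) - ?w (?\<gamma> j))" unfolding i j by (simp add: algebra_simps)
  finally have "r * norm (?w \<alpha> - ?w \<beta>) = r * norm (?w (?\<gamma> i) - ?w (?\<gamma> j))"
    using rigid[of "?w \<alpha> - ?w \<beta>"] c(1) by simp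
  then have "(norm (?w \<alpha> - ?w \<beta>))\<^sup>2 = (norm (?w (?\<gamma> i) - ?w (?\<gamma> j)))\<^sup>2" using c(1) by simp
  then have "cos (\<alpha> - \<beta>) = cos (?\<gamma> i - ?\<gamma> j)" unfolding norm_chord_squared by simp
  also have "?\<gamma> i - ?\<gamma> j = 2 * pi * of_int (int i - int j) / real m"
    by (simp add: diff_divide_distrib algebra_simps)
  \<comment> \<open>Equal cosines leave a sign open; it is absorbed by exchanging \<open>i\<close>
    and \<open>j\<close>.\<close>
  finally obtain N :: real where N: "N \<in> \<int>"
    "\<alpha> - \<beta> = 2 * pi * of_int (int i - int j) / real m + 2 * N * pi \<or>
     \<alpha> - \<beta> = - (2 * pi * of_int (int i - int j) / real m) + 2 * N * pi"
    unfolding cos_eq by blast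
  obtain n :: int where n: "N = of_int n" using N(1) by (auto elim: Ints_cases)
  have "real m \<noteq> 0" using m by simp
  from N(2) show ?thesis
  proof
    assume *: "\<alpha> - \<beta> = 2 * pi * of_int (int i - int j) / real m + 2 * N * pi"
    show ?thesis
      by (rule that[of "int i - int j" n, OF _ m(1)]) (use \<open>real m \<noteq> 0\<close> in \<open>simp add: * n field_simps\<close>)
  next
    assume *: "\<alpha> - \<beta> = - (2 * pi * of_int (int i - int j) / real m) + 2 * N * pi"
    show ?thesis
      by (rule that[of "int j - int i" n, OF _ m(1)]) (use \<open>real m \<noteq> 0\<close> in \<open>simp add: * n field_simps\<close>)
  qed
qed

lemma card_mod_4:
  "card {j. j < 4 * k \<and> P (j mod 4)} = k * card {i. i < 4 \<and> P i}" for k :: nat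
proof -
  have count: "card {j. j < N \<and> Q j} = (\<Sum>j<N. if Q j then 1 else 0)" for N :: nat and Q
    by (simp add: sum.If_cases Int_def lessThan_def)
  have "(\<Sum>j<4 * k. if P (j mod 4) then 1 else 0) = k * (\<Sum>j<4. if P j then 1 else (0::nat))"
  proof (induction k)
    case (Suc k)
    have eq: "4 * Suc k = Suc (Suc (Suc (Suc (4 * k))))" by simp
    have mods: "4 * k mod 4 = 0" "Suc (4 * k) mod 4 = 1" "Suc (Suc (4 * k)) mod 4 = 2"
      "Suc (Suc (Suc (4 * k))) mod 4 = 3" by presburger+
    have four: "{..<4} = {0, 1, 2, 3 :: nat}" by auto
    show ?case using Suc unfolding eq sum.lessThan_Suc mods by (simp add: four)
  qed simp
  then show ?thesis by (simp add: count)
qed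

section \<open>Sharpness\<close>

definition circle_point :: "real \<Rightarrow> pplane" where
  "circle_point \<theta> = aff (vector [cos \<theta>, sin \<theta>])"

text \<open>The direction perpendicular to the radius at angle \<sigma>, which is that of every
  chord whose end points have \<sigma> as the mean of their angles.\<close>

definition normal_direction :: "real \<Rightarrow> pplane" where
  "normal_direction \<sigma> = at_inf (vector [- sin \<sigma>, cos \<sigma>])"

lemma normal_vector_nonzero: "vector [- sin \<sigma>, cos \<sigma>] \<noteq> (0 :: real^2)"
  by (auto simp: vec2_eq_iff dest: sin_zero_abs_cos_one)

lemma circle_point_in: "circle_point \<theta> \<in> unit_circle"
  by (simp add: circle_point_def aff_in_unit_circle)

lemma normal_direction_in: "normal_direction \<sigma> \<in> line_at_infinity"
  using normal_vector_nonzero by (auto simp: normal_direction_def line_at_infinity_def)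

lemma circle_point_neq_normal_direction: "circle_point \<theta> \<noteq> normal_direction \<sigma>"
  using aff_neq_at_inf[OF normal_vector_nonzero] by (simp add: circle_point_def normal_direction_def)

lemma normal_direction_periodic: "normal_direction (\<sigma> + pi) = normal_direction \<sigma>"
  unfolding normal_direction_def using normal_vector_nonzero
  by (subst at_inf_eq_iff) (auto simp: vec2_eq_iff intro!: exI[of _ "-1"])

lemma circle_point_eq_iff: "circle_point \<alpha> = circle_point \<beta> \<longleftrightarrow> (\<exists>n::int. \<alpha> = \<beta> + 2 * pi * n)"
  unfolding circle_point_def aff_eq_iff sin_cos_eq_iff[symmetric] by (auto simp: vec2_eq_iff)

lemma normal_direction_eqD:
  assumes "normal_direction \<alpha> = normal_direction \<beta>" "\<bar>\<alpha> - \<beta>\<bar> < pi"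
  shows "\<alpha> = \<beta>"
proof -
  obtain k where "vector [- sin \<beta>, cos \<beta>] = k *\<^sub>R (vector [- sin \<alpha>, cos \<alpha>] :: real^2)"
    using assms(1) unfolding normal_direction_def
    by (subst (asm) at_inf_eq_iff[OF normal_vector_nonzero normal_vector_nonzero]) blast
  then have k: "sin \<beta> = k * sin \<alpha>" "cos \<beta> = k * cos \<alpha>" by (simp_all add: vec2_eq_iff)
  have "sin (\<alpha> - \<beta>) = 0" unfolding sin_diff k by simp
  then show ?thesis using sin_eq_0_pi[of "\<alpha> - \<beta>"] assms(2) by simp
qed

lemma chord_normal_direction:
  assumes "is_line L" "circle_point \<alpha> \<in> L" "circle_point \<beta> \<in> L" "circle_point \<alpha> \<noteq> circle_point \<beta>"
  shows "normal_direction ((\<alpha> + \<beta>) / 2) \<in> L"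
proof -
  obtain w where w: "w \<noteq> 0" "L = locus (\<lambda>v. w \<bullet> v = 0)" using assms is_line_iff by blast
  define \<sigma> \<delta> where "\<sigma> = (\<alpha> + \<beta>) / 2" and "\<delta> = (\<alpha> - \<beta>) / 2"
  have ab: "\<alpha> = \<sigma> + \<delta>" "\<beta> = \<sigma> - \<delta>" by (simp_all add: \<sigma>_def \<delta>_def field_simps)
  have eq: "w$1 * cos \<alpha> + w$2 * sin \<alpha> + w$3 = 0" "w$1 * cos \<beta> + w$2 * sin \<beta> + w$3 = 0"
    using assms(2,3) unfolding w(2) circle_point_def aff_mem_line by simp_all
  have "sin \<delta> \<noteq> 0"
  proof
    assume "sin \<delta> = 0"
    then have "circle_point \<alpha> = circle_point \<beta>"
      by (simp add: circle_point_def ab sin_add sin_diff cos_add cos_diff)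
    then show False using assms(4) by simp
  qed
  \<comment> \<open>The difference of the incidence equations of the two end points is 2 sin
    \<delta> times the incidence equation of the direction.\<close>
  moreover have "2 * sin \<delta> * (w$1 * - sin \<sigma> + w$2 * cos \<sigma>) =
      (w$1 * cos \<alpha> + w$2 * sin \<alpha> + w$3) - (w$1 * cos \<beta> + w$2 * sin \<beta> + w$3)"
    unfolding ab by (simp add: sin_add sin_diff cos_add cos_diff algebra_simps)
  ultimately have "w$1 * - sin \<sigma> + w$2 * cos \<sigma> = 0" using eq by simp
  then show ?thesis unfolding w(2) normal_direction_def \<sigma>_def[symmetric]
    by (subst at_inf_mem_line[OF normal_vector_nonzero]) simp
qed

lemma is_ellipse_unit_circle: "is_ellipse unit_circle"
  unfolding is_ellipse_def
  using affine_transformation_id is_circle_unit_circle by (metis image_id id_apply)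

text \<open>The regular \<open>4 k\<close>-gon, coloured in blocks of two. Vertices \<open>i\<close> and \<open>j\<close> span direction
  \<open>i + j\<close>, and \<open>1\<close> modulo \<open>4\<close> is not the sum of an element of \<open>{0, 1}\<close> and one of \<open>{2, 3}\<close>.
  A regular polygon through the adjacent vertices \<open>0\<close> and \<open>1\<close> has at least \<open>4 k\<close> vertices.\<close>

lemma two_block_configuration:
  assumes k: "k > 3"
  obtains B G R where "pierced_configuration (2 * k) B G R unit_circle line_at_infinity"
    "card R = 3 * k" "\<not> polygonal_up_to_affinity unit_circle B G R"
proof -
  define \<theta> :: "nat \<Rightarrow> real" where "\<theta> j = pi * real j / real (2 * k)" for j
  define P where "P j = circle_point (\<theta> j)" for j
  \<comment> \<open>Half the vertex angle: the chord between vertices i and j then has direction D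
    (i + j).\<close>
  define D where "D j = normal_direction (\<theta> j / 2)" for j
  define IB where "IB = {j. j < 4 * k \<and> j mod 4 < 2}"
  define IG where "IG = {j. j < 4 * k \<and> \<not> j mod 4 < 2}"
  define IR where "IR = {j. j < 4 * k \<and> j mod 4 \<noteq> 1}"
  have k0: "real k > 0" using k by simp
  have P_inj: "i = j" if "P i = P j" "i < 4 * k" "j < 4 * k" for i j
  proof -
    obtain n :: int where n: "\<theta> i = \<theta> j + 2 * pi * n"
      using \<open>P i = P j\<close> unfolding P_def circle_point_eq_iff by blast
    then have "pi * real i = pi * (real j + real_of_int n * (4 * real k))"
      using k0 by (simp add: \<theta>_def field_simps)
    then have "real i = real j + real_of_int n * (4 * real k)" by simp
    then have "real_of_int (int i) = real_of_int (int j + n * int (4 * k))" by simp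
    then have "int i = int j + n * int (4 * k)" by (simp only: of_int_eq_iff)
    then have "int i mod int (4 * k) = int j mod int (4 * k)" by simp
    then show ?thesis using that(2,3) by (simp flip: zmod_int)
  qed
  have D_inj: "inj_on D {..<4 * k}"
  proof (rule inj_onI)
    fix i j assume ij: "i \<in> {..<4 * k}" "j \<in> {..<4 * k}" "D i = D j"
    have range: "0 \<le> \<theta> i / 2 \<and> \<theta> i / 2 < pi" if "i < 4 * k" for i
      using that k0 by (simp add: \<theta>_def field_simps)
    have "\<bar>\<theta> i / 2 - \<theta> j / 2\<bar> < pi" using range[of i] range[of j] ij by auto
    then have "\<theta> i / 2 = \<theta> j / 2" using ij(3) unfolding D_def by (intro normal_direction_eqD)
    then show "i = j" using k0 by (simp add: \<theta>_def)
  qed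
  \<comment> \<open>Sums of two indices stay below 8k, and lowering one by 4k turns the normal by
    pi, which is the same direction.\<close>
  have D_mod: "D s = D (s mod (4 * k))" if "s < 8 * k" for s
  proof (cases "s < 4 * k")
    case False
    then have "s mod (4 * k) = s - 4 * k" using that by (simp add: mod_if)
    moreover have "\<theta> s / 2 = \<theta> (s - 4 * k) / 2 + pi"
      using False k0 by (simp add: \<theta>_def of_nat_diff field_simps)
    ultimately show ?thesis unfolding D_def by (simp only: normal_direction_periodic)
  qed simp
  have "card {i. i < 4 \<and> i < (2::nat)} = 2" "card {i. i < 4 \<and> \<not> i < (2::nat)} = 2"
    "card {i. i < 4 \<and> i \<noteq> (1::nat)} = 3"
  proof -
    have "{i. i < 4 \<and> i < (2::nat)} = {0, 1}" "{i. i < 4 \<and> \<not> i < (2::nat)} = {2, 3}"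
      "{i. i < 4 \<and> i \<noteq> (1::nat)} = {0, 2, 3}" by auto
    then show "card {i. i < 4 \<and> i < (2::nat)} = 2" "card {i. i < 4 \<and> \<not> i < (2::nat)} = 2"
      "card {i. i < 4 \<and> i \<noteq> (1::nat)} = 3" by simp_all
  qed
  then have cards: "card IB = 2 * k" "card IG = 2 * k" "card IR = 3 * k"
    unfolding IB_def IG_def IR_def
    using card_mod_4[of k "\<lambda>i. i < 2"] card_mod_4[of k "\<lambda>i. \<not> i < 2"] card_mod_4[of k "\<lambda>i. i \<noteq> 1"]
    by simp_all
  have "inj_on P IB" "inj_on P IG" using P_inj by (auto simp: inj_on_def IB_def IG_def)
  then have card_BG: "card (P ` IB) = 2 * k" "card (P ` IG) = 2 * k" by (simp_all add: card_image cards)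
  have "inj_on D IR" by (rule inj_on_subset[OF D_inj]) (auto simp: IR_def)
  then have card_R: "card (D ` IR) = 3 * k" by (simp add: card_image cards)
  have P_D: "P i \<noteq> D j" for i j unfolding P_def D_def by (rule circle_point_neq_normal_direction)
  have conf: "pierced_configuration (2 * k) (P ` IB) (P ` IG) (D ` IR) unit_circle line_at_infinity"
    unfolding pierced_configuration_def
  proof (intro conjI)
    show "P ` IB \<inter> P ` IG = {}" using P_inj by (fastforce simp: IB_def IG_def)
    show "P ` IB \<inter> D ` IR = {}" "P ` IG \<inter> D ` IR = {}" using P_D by auto
    have "is_quadric unit_circle" using is_ellipse_unit_circle by (simp add: is_quadric_def)
    then show "general_position (P ` IB \<union> P ` IG)"
      by (intro general_position_subset[OF general_position_quadric]) (auto simp: P_def circle_point_in)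
    show "is_quadric unit_circle" by fact
    show "card (P ` IB) = 2 * k" "card (P ` IG) = 2 * k" by (fact card_BG)+
    show "6 < 2 * k" using k by simp
    show "finite (D ` IR)" by (simp add: IR_def)
    show "is_line line_at_infinity" by (simp add: is_line_def)
    show "P ` IB \<union> P ` IG \<union> D ` IR \<subseteq> unit_circle \<union> line_at_infinity"
      by (auto simp: P_def D_def circle_point_in normal_direction_in)
    show "\<forall>b\<in>P ` IB. \<forall>g\<in>P ` IG. \<forall>L. is_line L \<and> b \<in> L \<and> g \<in> L \<longrightarrow> (\<exists>r\<in>D ` IR. r \<in> L)"
    proof (intro ballI allI impI)
      fix b g L assume "b \<in> P ` IB" "g \<in> P ` IG" and L: "is_line L \<and> b \<in> L \<and> g \<in> L"
      then obtain i j where ij: "i \<in> IB" "b = P i" "j \<in> IG" "g = P j" by blast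
      have "i < 4 * k" "j < 4 * k" "i \<noteq> j" using ij by (auto simp: IB_def IG_def)
      then have "P i \<noteq> P j" using P_inj by blast
      then have "normal_direction ((\<theta> i + \<theta> j) / 2) \<in> L"
        using L ij unfolding P_def by (intro chord_normal_direction) auto
      also have "normal_direction ((\<theta> i + \<theta> j) / 2) = D (i + j)"
        by (simp add: D_def \<theta>_def add_divide_distrib distrib_left)
      also have "\<dots> = D ((i + j) mod (4 * k))" using \<open>i < 4 * k\<close> \<open>j < 4 * k\<close> by (intro D_mod) simp
      finally have "D ((i + j) mod (4 * k)) \<in> L" .
      moreover have "(i + j) mod (4 * k) \<in> IR"
      proof -
        \<comment> \<open>As 4 divides 4k, reducing the index modulo 4k keeps its residue modulo
          4.\<close>
        have "(i + j) mod (4 * k) mod 4 = (i + j) mod 4" by (simp add: mod_mod_cancel)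
        moreover have "(i + j) mod 4 \<noteq> 1" using ij(1,3) unfolding IB_def IG_def mem_Collect_eq by presburger
        ultimately show ?thesis using k by (simp add: IR_def)
      qed
      ultimately show "\<exists>r\<in>D ` IR. r \<in> L" by blast
    qed
  qed
  have "\<not> polygonal_up_to_affinity unit_circle (P ` IB) (P ` IG) (D ` IR)"
  proof
    assume "polygonal_up_to_affinity unit_circle (P ` IB) (P ` IG) (D ` IR)"
    then obtain T m where T: "affine_transformation T" "is_circle (T ` unit_circle)" "m \<le> 3 * k"
        "within_inscribed_regular_polygon m (T ` unit_circle) (T ` P ` IB)"
      unfolding polygonal_up_to_affinity_def card_R by blast
    have "1 \<in> IB" "0 \<in> IB" using k by (auto simp: IB_def)
    then have mem: "aff (vector [cos (\<theta> 1), sin (\<theta> 1)]) \<in> P ` IB" "aff (vector [cos (\<theta> 0), sin (\<theta> 0)]) \<in> P ` IB"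
      by (auto simp: P_def circle_point_def)
    \<comment> \<open>The adjacent vertices 0 and 1 differ by the angle pi / (2k), so the relation
      becomes m = 4k (d + n m). Since m > 0, this gives m >= 4k, more than the 3k available.\<close>
    obtain d n :: int where "(\<theta> 1 - \<theta> 0) * real m = 2 * pi * real_of_int (d + n * int m)" "m \<ge> 3"
      using inscribed_polygon_chord[OF T(1,2,4) mem] by blast
    then have m: "pi * real m = pi * (4 * real k * real_of_int (d + n * int m))" "m \<ge> 3"
      using k0 by (simp_all add: \<theta>_def field_simps)
    then have "real m = 4 * real k * real_of_int (d + n * int m)" by simp
    then have "real_of_int (int m) = real_of_int (int (4 * k) * (d + n * int m))" by simp
    then have "int m = int (4 * k) * (d + n * int m)" by (simp only: of_int_eq_iff)
    then have "int (4 * k) dvd int m" by (metis dvd_triv_left)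
    then have "4 * k \<le> m" using m(2) by (simp only: int_dvd_int_iff) (auto dest: dvd_imp_le)
    then show False using T(3) k by simp
  qed
  then show ?thesis using that conf card_R by blast
qed

text \<open>Being an ellipse is not a projective notion: moving \<open>l\<close> to infinity can
  change the affine type of \<open>Q\<close>. The claim is therefore made relative to
  \<open>l\<close>, for every projective map that sends \<open>l\<close> to infinity. Optimality is
  shown for each even n > 6, where 3n/2 is an integer, by a configuration that attains this value
  and violates the polygon conclusion.\<close>

theorem theorem1p11:
  "(\<forall>n B G R Q l.
      pierced_configuration n B G R Q l \<and> real (card R) < 3 / 2 * real n \<longrightarrow>
        B \<subseteq> Q \<and> G \<subseteq> Q \<and>
        (\<forall>T. projective_transformation T \<and> T ` l = line_at_infinity \<longrightarrow> is_ellipse (T ` Q)) \<and>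
        (l = line_at_infinity \<longrightarrow> is_ellipse Q \<and> polygonal_up_to_affinity Q B G R)) \<and>
   (\<forall>n. n > 6 \<and> even n \<longrightarrow>
      (\<exists>B G R Q.
         pierced_configuration n B G R Q line_at_infinity \<and> real (card R) = 3 / 2 * real n \<and>
         \<not> polygonal_up_to_affinity Q B G R))"
proof (intro conjI allI impI; (elim conjE)?)
  fix n B G R Q l
  assume conf: "pierced_configuration n B G R Q l" and "real (card R) < 3 / 2 * real n"
  then have small: "2 * card R < 3 * n" by linarith
  show "B \<subseteq> Q" by (rule pierced_configuration_subset_quadric[OF conf small])
  show "G \<subseteq> Q" by (rule pierced_configuration_subset_quadric[OF pierced_configuration_swap[OF conf] small])
  show "is_ellipse (T ` Q)" if "projective_transformation T" "T ` l = line_at_infinity" for T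
    by (rule pierced_configuration_ellipse[OF conf small that])
  assume l: "l = line_at_infinity"
  show "is_ellipse Q"
    using pierced_configuration_ellipse[OF conf small affine_imp_projective[OF affine_transformation_id]] l
    by simp
  show "polygonal_up_to_affinity Q B G R"
    using pierced_configuration_polygonal conf small l by blast
next
  fix n :: nat assume "n > 6" "even n"
  then obtain k where "n = 2 * k" "k > 3" by (auto elim: evenE)
  moreover obtain B G R where "pierced_configuration (2 * k) B G R unit_circle line_at_infinity"
    "card R = 3 * k" "\<not> polygonal_up_to_affinity unit_circle B G R"
    using two_block_configuration[OF \<open>k > 3\<close>] by blast
  ultimately show "\<exists>B G R Q. pierced_configuration n B G R Q line_at_infinity \<and>
      real (card R) = 3 / 2 * real n \<and> \<not> polygonal_up_to_affinity Q B G R"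
    by (intro exI[of _ B] exI[of _ G] exI[of _ R] exI[of _ unit_circle]) simp
qed

end
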